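(* Let $m\in\mathbb{N}$ and let $g$ be a holomorphic function in $\mathbb{D}$. For $n\in\mathbb{Z}_+$ put $g_n(z)=z^n g(z)$. Suppose that $g_n\in\mathcal{I}_{n,m}$ for every $n\in\mathbb{Z}_+$. Then $g$ is a rational function of type $(m,m)$ holomorphic in $\mathbb{D}$.
   Context: $\mathbb{D}$ is the open unit disk in $\mathbb{C}$, $\mathbb{N}=\{1,2,\ldots\}$, $\mathbb{Z}_+=\mathbb{N}\cup\{0\}$. $\mathcal{P}_n$ denotes the set of complex polynomials of degree at most $n$. For a function $h$ holomorphic in $\mathbb{D}$, $\mathrm{z}(h)$ denotes the number of zeros of $h$ in $\mathbb{D}$ counting multiplicities (with $\mathrm{z}(h)=\infty$ if $h\equiv0$). For $n\in\mathbb{Z}_+$ and $m\in\mathbb{N}$, $$\mathcal{I}_{n,m}:=\left\{h:\ h\text{ is holomorphic in }\mathbb{D},\ \mathrm{z}(h+p)\leq m+n\ \text{for every } p\in\mathcal{P}_n\right\}.$$ A rational function of type $(m,m)$ is a quotient of two polynomials each of degree at most $m$ (denominator not identically zero). *)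

theory Defs
  imports "HOL-Complex_Analysis.Complex_Analysis" "HOL-Library.Extended_Nat"
begin

abbreviation unit_disk :: "complex set" where
  "unit_disk \<equiv> ball 0 1"

(* Intended for functions holomorphic in the disk. If h vanishes identically there, its
   zero set is infinite, so the value is infinity; otherwise zorder is the
   multiplicity of each zero. *)
definition disk_zeros :: "(complex \<Rightarrow> complex) \<Rightarrow> enat" where
  "disk_zeros h =
     (if finite {z \<in> unit_disk. h z = 0}
      then enat (\<Sum>z \<in> {z \<in> unit_disk. h z = 0}. nat (zorder h z))
      else \<infinity>)"

definition I_class :: "nat \<Rightarrow> nat \<Rightarrow> (complex \<Rightarrow> complex) set" where
  "I_class n m =
     {h. h holomorphic_on unit_disk \<and>
         (\<forall>p :: complex poly. degree p \<le> n \<longrightarrow> disk_zeros (\<lambda>z. h z + poly p z) \<le> enat (m + n))}"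

(* The representing fraction has no zero of its denominator in S, so that f is
   a rational function without poles in S and the totalised division by 0 plays no role. *)
definition holomorphic_rational_on :: "nat \<Rightarrow> nat \<Rightarrow> complex set \<Rightarrow> (complex \<Rightarrow> complex) \<Rightarrow> bool" where
  "holomorphic_rational_on k l S f \<longleftrightarrow>
     (\<exists>P Q :: complex poly. degree P \<le> k \<and> degree Q \<le> l \<and> Q \<noteq> 0 \<and>
        (\<forall>z\<in>S. poly Q z \<noteq> 0 \<and> f z = poly P z / poly Q z))"

end

theory Submission
  imports Defs "HOL-Computational_Algebra.Fundamental_Theorem_Algebra"
begin

text \<open>
  Let \<open>C m\<close> be the class of all \<open>f\<close> holomorphic in the disk such that \<open>z ^ n * f + p\<close> has at most
  \<open>m + n\<close> zeros for all \<open>n\<close> and all \<open>p\<close> of degree at most \<open>n\<close>. Up to a constant, \<open>C m\<close> is closed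
  under taking the nonnegative powers in the Laurent expansion of \<open>u (1 / z) * f (z)\<close>, if the
  polynomial \<open>u\<close> with \<open>u 0 = 1\<close> is close enough to 1 on a disk of radius greater than 1.

  If \<open>f = z ^ m * \<Phi>\<close> lies in \<open>C m\<close>, then \<open>\<Phi>\<close> has no zeros and \<open>\<psi> = \<Phi> 0 / \<Phi>\<close> is bounded by
  a constant depending on \<open>m\<close> only. For \<open>l \<ge> m\<close> the closure property yields holomorphic curves
  \<open>\<mu> \<mapsto> \<Phi> * (1 - \<mu> * (shift of \<psi> by l))\<close> inside the class. Along such a curve the
  coefficient of \<open>\<psi>\<close> at 1 moves with initial velocity the coefficient at \<open>l + 1\<close>, so that, the
  coefficients being uniformly bounded, a maximum principle forces the latter to vanish. Hence
  \<open>\<psi>\<close> is a polynomial of degree at most \<open>m\<close>. The general case reduces to this one by dividing out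
  the zeros of a function \<open>z ^ n * f + p\<close> that has the maximal number of zeros.
\<close>

subsection \<open>Zeros in a disk\<close>

text \<open>This is 0 if \<open>f\<close> has infinitely many zeros in \<open>S\<close>; below, \<open>S\<close> is a ball of radius less than 1.\<close>

definition zcount :: "(complex \<Rightarrow> complex) \<Rightarrow> complex set \<Rightarrow> nat" where
  "zcount f S = (\<Sum>z\<in>{z\<in>S. f z = 0}. nat (zorder f z))"

lemma zcount_cong:
  assumes "open S" "\<And>z. z \<in> S \<Longrightarrow> f z = g z"
  shows "zcount f S = zcount g S"
proof -
  have "zorder f z = zorder g z" if "z \<in> S" for z
  proof (rule zorder_cong[OF _ refl])
    have "\<forall>\<^sub>F w in at z. w \<in> S"
      using assms(1) that by (simp add: eventually_at_in_open')
    then show "\<forall>\<^sub>F w in at z. f w = g w"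
      by eventually_elim (use assms(2) in auto)
  qed
  then show ?thesis
    unfolding zcount_def by (intro sum.cong) (use assms(2) in auto)
qed

lemma finite_zeros_cball:
  assumes f: "f holomorphic_on ball 0 1" and nz: "\<exists>z\<in>ball 0 1. f z \<noteq> 0" and s: "s < 1"
  shows "finite {z \<in> cball 0 s. f z = (0::complex)}"
proof (cases "f constant_on ball 0 1")
  case True
  then obtain c where c: "\<And>z. z \<in> ball 0 1 \<Longrightarrow> f z = c" by (auto simp: constant_on_def)
  with nz have "c \<noteq> 0" by auto
  then have "{z \<in> cball 0 s. f z = 0} = {}" using c s by force
  then show ?thesis by (metis finite.emptyI)
next
  case False
  then show ?thesis
    by (intro holomorphic_compact_finite_zeros[OF f]) (use s in auto)
qed

lemma finite_zeros_ball:
  assumes "f holomorphic_on ball 0 1" "\<exists>z\<in>ball 0 1. f z \<noteq> 0" "s < 1"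
  shows "finite {z \<in> ball 0 s. f z = (0::complex)}"
  by (rule finite_subset[OF _ finite_zeros_cball[OF assms]]) auto

lemma eventually_nonzero_at:
  assumes f: "f holomorphic_on ball 0 1" and nz: "\<exists>z\<in>ball 0 1. f z \<noteq> 0" and a: "norm a < 1"
  shows "\<forall>\<^sub>F z in at a. f z \<noteq> (0::complex)"
proof -
  obtain s where s: "norm a < s" "s < 1" using a dense by blast
  define Z where "Z = {z \<in> ball 0 s. f z = 0}"
  have "finite Z" unfolding Z_def by (rule finite_zeros_ball[OF f nz s(2)])
  then have "\<forall>\<^sub>F z in at a. z \<notin> Z"
    using islimpt_finite[of Z a] by (auto simp: islimpt_iff_eventually)
  moreover have "\<forall>\<^sub>F z in at a. z \<in> ball 0 s"
    using s by (intro eventually_at_in_open') auto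
  ultimately show ?thesis by eventually_elim (auto simp: Z_def)
qed

lemma analytic_on_unit_ball_point:
  assumes "f holomorphic_on ball 0 1" "norm a < 1"
  shows "f analytic_on {a}"
  using assms by (auto simp: analytic_at intro!: exI[of _ "ball 0 1"])

lemma zorder_pos_iff_unit_ball:
  assumes f: "f holomorphic_on ball 0 1" and nz: "\<exists>z\<in>ball 0 1. f z \<noteq> 0" and a: "norm a < 1"
  shows "zorder f a > 0 \<longleftrightarrow> f a = (0::complex)" "zorder f a \<ge> 0" "f a \<noteq> 0 \<Longrightarrow> zorder f a = 0"
proof -
  have fr: "\<exists>\<^sub>F z in at a. f z \<noteq> 0"
    using eventually_nonzero_at[OF assms] by (rule eventually_frequently[rotated]) simp
  note an = analytic_on_unit_ball_point[OF f a]
  show 1: "zorder f a > 0 \<longleftrightarrow> f a = 0" by (rule zorder_pos_iff'[OF an fr])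
  show 2: "zorder f a \<ge> 0" by (rule zorder_ge_0[OF an fr])
  show "zorder f a = 0" if "f a \<noteq> 0" using 1 2 that by linarith
qed

section \<open>Splitting off zeros by polynomial factors\<close>

lemma zcount_linear_times:
  assumes G: "G holomorphic_on ball 0 1" and nz: "\<exists>z\<in>ball 0 1. G z \<noteq> 0"
    and s: "norm a < s" "s < 1"
  shows "zcount (\<lambda>z. (z - a) * G z) (ball 0 s) = Suc (zcount G (ball 0 s))"
proof -
  let ?f = "\<lambda>z. (z - a) * G z"
  let ?Z = "{z \<in> ball 0 s. G z = 0}"
  have fin: "finite ?Z" by (rule finite_zeros_ball[OF G nz s(2)])
  have zo: "zorder ?f z = (if z = a then 1 else 0) + zorder G z" if z: "norm z < 1" for z
  proof -
    have "\<forall>\<^sub>F w in at z. w \<noteq> a"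
      by (metis eventually_neq_at_within)
    then have ev: "\<forall>\<^sub>F w in at z. (w - a) * G w \<noteq> 0"
      using eventually_nonzero_at[OF G nz z] by eventually_elim auto
    have "zorder ?f z = zorder (\<lambda>w. w - a) z + zorder G z"
      by (rule zorder_times_analytic[OF _ analytic_on_unit_ball_point[OF G z] ev])
        (auto intro!: analytic_intros)
    moreover have "zorder (\<lambda>w. w - a) z = (if z = a then 1 else 0)"
    proof (cases "z = a")
      case True
      then show ?thesis
        by (auto intro!: zorder_eqI[of UNIV a "\<lambda>_. 1"])
    next
      case False
      then show ?thesis
        by (auto intro!: zorder_eqI[of UNIV z "\<lambda>w. w - a"] holomorphic_intros)
    qed
    ultimately show ?thesis by simp
  qed
  \<comment> \<open>\<open>a\<close> may or may not be a zero of \<open>G\<close>. Summing over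
    \<open>insert a ?Z\<close> covers both cases, since \<open>zorder G a = 0\<close> when
    \<open>G a\<close> is nonzero.\<close>
  have "{z \<in> ball 0 s. ?f z = 0} = insert a ?Z" using s by auto
  then have "zcount ?f (ball 0 s) = (\<Sum>z\<in>insert a ?Z. nat ((if z = a then 1 else 0) + zorder G z))"
    unfolding zcount_def using zo s by (intro sum.cong) auto
  also have "\<dots> = (\<Sum>z\<in>insert a ?Z. (if z = a then 1 else 0) + nat (zorder G z))"
  proof (intro sum.cong refl)
    fix z assume "z \<in> insert a ?Z"
    then have "norm z < 1" using s by auto
    then show "nat ((if z = a then 1 else 0) + zorder G z) = (if z = a then 1 else 0) + nat (zorder G z)"
      using zorder_pos_iff_unit_ball(2)[OF G nz, of z] by (auto simp: nat_add_distrib)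
  qed
  also have "\<dots> = 1 + (\<Sum>z\<in>insert a ?Z. nat (zorder G z))"
    using fin by (simp add: sum.distrib)
  also have "(\<Sum>z\<in>insert a ?Z. nat (zorder G z)) = (\<Sum>z\<in>?Z. nat (zorder G z))"
  proof (rule sum.mono_neutral_right)
    show "\<forall>i\<in>insert a ?Z - ?Z. nat (zorder G i) = 0"
    proof
      fix i assume "i \<in> insert a ?Z - ?Z"
      then have "norm i < 1" "G i \<noteq> 0" using s by auto
      then show "nat (zorder G i) = 0" using zorder_pos_iff_unit_ball(3)[OF G nz] by simp
    qed
  qed (use fin in auto)
  finally show ?thesis by (simp add: zcount_def)
qed

lemma zcount_mono:
  assumes "f holomorphic_on ball 0 1" "\<exists>z\<in>ball 0 1. f z \<noteq> 0" "s \<le> t" "t < 1"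
  shows "zcount f (ball 0 s) \<le> zcount f (ball 0 t)"
  unfolding zcount_def
  by (rule sum_mono2[OF finite_zeros_ball[OF assms(1,2,4)]]) (use assms(3) in auto)

lemma zcount_less:
  assumes f: "f holomorphic_on ball 0 1" and nz: "\<exists>z\<in>ball 0 1. f z \<noteq> 0"
    and a: "s \<le> norm a" "norm a < t" "t < 1" "f a = 0"
  shows "zcount f (ball 0 s) < zcount f (ball 0 t)"
  unfolding zcount_def
proof (rule sum_strict_mono2[OF finite_zeros_ball[OF f nz a(3)], of _ a])
  show "0 < nat (zorder f a)" using zorder_pos_iff_unit_ball(1)[OF f nz, of a] a by auto
qed (use a in auto)

lemma zcount_poly_times:
  assumes "G holomorphic_on ball 0 1" "\<exists>z\<in>ball 0 1. G z \<noteq> 0" "s < 1"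
    and "Q \<noteq> 0" "\<And>z. poly Q z = 0 \<Longrightarrow> norm z < s"
  shows "zcount (\<lambda>z. poly Q z * G z) (ball 0 s) = degree Q + zcount G (ball 0 s)"
  using assms(4,5)
proof (induction "degree Q" arbitrary: Q)
  case 0
  then obtain c where c: "Q = [:c:]" "c \<noteq> 0" using degree_0_id by (metis degree_pCons_0 pCons_0_0 degree_eq_zeroE)
  have "zorder (\<lambda>z. c * G z) z = zorder G z" for z using c by (intro zorder_cmult) auto
  then show ?case using 0 c by (simp add: zcount_def)
next
  case (Suc n)
  have "\<not> constant (poly Q)" using Suc.hyps(2) by (simp add: constant_degree)
  then obtain a where a: "poly Q a = 0" using fundamental_theorem_of_algebra by blast
  then obtain R where R: "Q = [:-a, 1:] * R" by (metis poly_eq_0_iff_dvd dvdE)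
  have R0: "R \<noteq> 0" using R Suc.prems by auto
  have dR: "degree Q = Suc (degree R)" using R R0 by (simp add: degree_mult_eq del: mult_pCons_left)
  have rR: "norm z < s" if "poly R z = 0" for z using that R Suc.prems(2) by simp
  have IH: "zcount (\<lambda>z. poly R z * G z) (ball 0 s) = degree R + zcount G (ball 0 s)"
    using Suc.hyps(1)[of R] Suc.hyps(2) dR R0 rR by auto
  have hol: "(\<lambda>z. poly R z * G z) holomorphic_on ball 0 1"
    using assms(1) by (auto intro!: holomorphic_intros)
  have "\<exists>z\<in>ball 0 1. poly R z * G z \<noteq> 0"
  proof -
    \<comment> \<open>Zeros of \<open>G\<close> and of \<open>R\<close> are isolated, so the product
      is nonzero at all points close to 0, apart possibly from 0 itself.\<close>
    have "\<forall>\<^sub>F z in at 0. G z \<noteq> 0" by (rule eventually_nonzero_at[OF assms(1,2)]) simp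
    moreover have "\<forall>\<^sub>F z in at 0. poly R z \<noteq> 0"
      using islimpt_finite[OF poly_roots_finite[OF R0], of 0] by (auto simp: islimpt_iff_eventually)
    moreover have "\<forall>\<^sub>F z in at (0::complex). z \<in> ball 0 1" by (intro eventually_at_in_open') auto
    ultimately have "\<forall>\<^sub>F z in at 0. z \<in> ball 0 1 \<and> poly R z * G z \<noteq> 0" by eventually_elim auto
    then show ?thesis using eventually_happens[of _ "at (0::complex)"] by fastforce
  qed
  from zcount_linear_times[OF hol this Suc.prems(2)[OF a] \<open>s < 1\<close>] IH
  have "zcount (\<lambda>z. (z - a) * (poly R z * G z)) (ball 0 s) = degree Q + zcount G (ball 0 s)"
    by (simp add: dR)
  moreover have "poly Q z * G z = (z - a) * (poly R z * G z)" for z by (simp add: R algebra_simps)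
  ultimately show ?case by (simp only:)
qed

text \<open>The zeros are split off one at a time by the difference quotient at a zero, whose
  singularity is removable. The cofactor may keep further zeros in the ball.\<close>

lemma zcount_ge_imp_factor:
  assumes "f holomorphic_on ball 0 1" "\<exists>z\<in>ball 0 1. f z \<noteq> 0" "s < 1"
    and "k \<le> zcount f (ball 0 s)"
  obtains Q h where "degree Q = k" "Q \<noteq> 0" "\<And>z. poly Q z = 0 \<Longrightarrow> norm z < s"
    "h holomorphic_on ball 0 1" "\<exists>z\<in>ball 0 1. h z \<noteq> 0" "\<And>z. norm z < 1 \<Longrightarrow> f z = poly Q z * h z"
  using assms(1,2,4)
proof (induction k arbitrary: f thesis)
  case 0
  show ?case by (rule "0.prems"(1)[of "1" f]) (use 0 in auto)
next
  case (Suc k)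
  have "{z \<in> ball 0 s. f z = 0} \<noteq> {}"
  proof
    assume "{z \<in> ball 0 s. f z = 0} = {}"
    then show False using Suc.prems(4) unfolding zcount_def by (metis sum.empty not_less_eq_eq le0)
  qed
  then obtain a where a: "norm a < s" "f a = 0" by auto
  define h where "h = (\<lambda>z. if z = a then deriv f a else (f z - f a) / (z - a))"
  have h: "h holomorphic_on ball 0 1"
    unfolding h_def using Suc.prems(2) by (intro pole_lemma_open) auto
  have fh: "f z = (z - a) * h z" for z using a by (auto simp: h_def)
  have nz: "\<exists>z\<in>ball 0 1. h z \<noteq> 0" using Suc.prems(3) fh by auto
  have "zcount (\<lambda>z. (z - a) * h z) (ball 0 s) = Suc (zcount h (ball 0 s))"
    by (rule zcount_linear_times[OF h nz a(1) assms(3)])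
  then have k: "k \<le> zcount h (ball 0 s)" 
    using Suc.prems(4) fh by (metis (no_types, lifting) Suc_le_mono zcount_cong open_ball)
  obtain Q g where Q: "degree Q = k" "Q \<noteq> 0" "\<And>z. poly Q z = 0 \<Longrightarrow> norm z < s"
    "g holomorphic_on ball 0 1" "\<exists>z\<in>ball 0 1. g z \<noteq> 0" "\<And>z. norm z < 1 \<Longrightarrow> h z = poly Q z * g z"
    using Suc.IH[OF _ h nz k] by blast
  show ?case
  proof (rule Suc.prems(1)[of "[:-a, 1:] * Q" g])
    show "degree ([:-a, 1:] * Q) = Suc k" using Q by (simp add: degree_mult_eq del: mult_pCons_left)
    show "[:-a, 1:] * Q \<noteq> 0" using Q(2) by (metis mult_eq_0_iff pCons_eq_0_iff one_neq_zero)
    show "norm z < s" if "poly ([:-a, 1:] * Q) z = 0" for z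
      using that Q(3) a(1) by (auto simp del: mult_pCons_left)
    show "f z = poly ([:-a, 1:] * Q) z * g z" if "norm z < 1" for z
      using Q(6)[OF that] fh[of z] by (simp add: algebra_simps)
  qed (use Q in auto)
qed

text \<open>The general Rouche theorem compares sums weighted by winding numbers. It is applied in a
  ball of radius \<open>t\<close> between \<open>s\<close> and 1: the circle of radius
  \<open>s\<close> winds once around the zeros inside it and not at all around those outside, and
  the strict inequality excludes zeros on the circle.\<close>

lemma Rouche_circle:
  assumes f: "f holomorphic_on ball 0 1" and e: "e holomorphic_on ball 0 1"
    and s: "0 < s" "s < 1"
    and less: "\<And>z. norm z = s \<Longrightarrow> norm (e z) < norm (f z)"
  shows "zcount (\<lambda>z. f z + e z) (ball 0 s) = zcount f (ball 0 s)"
proof -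
  obtain t where t: "s < t" "t < 1" using s dense by blast
  let ?fe = "\<lambda>z. f z + e z"
  have zs: "complex_of_real s \<in> ball 0 1" "norm (complex_of_real s) = s" using s by auto
  have nzf: "\<exists>z\<in>ball 0 1. f z \<noteq> 0" using less[OF zs(2)] zs(1) by (intro bexI[of _ "of_real s"]) auto
  have fe_s: "?fe z \<noteq> 0" if "norm z = s" for z
    using less[OF that] by (metis add_eq_0_iff norm_minus_cancel order_less_irrefl)
  have nzfe: "\<exists>z\<in>ball 0 1. ?fe z \<noteq> 0"
    using fe_s[OF zs(2)] zs(1) by blast
  have hfe: "?fe holomorphic_on ball 0 1" using f e by (intro holomorphic_intros)
  have sub: "ball 0 t \<subseteq> ball (0::complex) 1" using t by auto
  have main: "(\<Sum>p\<in>{p \<in> ball 0 t. ?fe p = 0}. winding_number (circlepath 0 s) p * zorder ?fe p)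
     = (\<Sum>p\<in>{p \<in> ball 0 t. f p = 0}. winding_number (circlepath 0 s) p * zorder f p)"
  proof (rule Rouche_theorem)
    show "finite {p \<in> ball 0 t. f p + e p = 0}" by (rule finite_zeros_ball[OF hfe nzfe t(2)])
    show "finite {p \<in> ball 0 t. f p = 0}" by (rule finite_zeros_ball[OF f nzf t(2)])
    show "\<forall>z. z \<notin> ball 0 t \<longrightarrow> winding_number (circlepath 0 s) z = 0"
      using s t by (auto intro!: winding_number_zero_outside[of _ "ball 0 t"])
  qed (use holomorphic_on_subset[OF f sub] holomorphic_on_subset[OF e sub] less s t in \<open>auto simp: dist_norm\<close>)
  have red: "(\<Sum>p\<in>{p \<in> ball 0 t. g p = 0}. winding_number (circlepath 0 s) p * zorder g p)
      = of_nat (zcount g (ball 0 s))"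
    if g: "g holomorphic_on ball 0 1" "\<exists>z\<in>ball 0 1. g z \<noteq> 0" and gs: "\<And>z. norm z = s \<Longrightarrow> g z \<noteq> 0" for g
  proof -
    have "(\<Sum>p\<in>{p \<in> ball 0 t. g p = 0}. winding_number (circlepath 0 s) p * zorder g p)
      = (\<Sum>p\<in>{p \<in> ball 0 s. g p = 0}. of_nat (nat (zorder g p)))"
    proof (rule sum.mono_neutral_cong_right)
      show "finite {p \<in> ball 0 t. g p = 0}" by (rule finite_zeros_ball[OF g t(2)])
      show "\<forall>i\<in>{p \<in> ball 0 t. g p = 0} - {p \<in> ball 0 s. g p = 0}.
         winding_number (circlepath 0 s) i * of_int (zorder g i) = 0"
      proof
        fix i assume "i \<in> {p \<in> ball 0 t. g p = 0} - {p \<in> ball 0 s. g p = 0}"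
        then have "norm i > s" using gs[of i] by force
        then have "winding_number (circlepath 0 s) i = 0"
          using s by (intro winding_number_zero_outside[of _ "cball 0 s"]) auto
        then show "winding_number (circlepath 0 s) i * of_int (zorder g i) = 0" by simp
      qed
      fix x assume "x \<in> {p \<in> ball 0 s. g p = 0}"
      then show "winding_number (circlepath 0 s) x * of_int (zorder g x) = of_nat (nat (zorder g x))"
        using zorder_pos_iff_unit_ball(2)[OF g, of x] s winding_number_circlepath[of x 0 s]
        by (simp add: of_nat_nat)
    qed (use t in auto)
    then show ?thesis by (simp add: zcount_def)
  qed
  have fs: "f z \<noteq> 0" if "norm z = s" for z using less[OF that] by auto
  have "(of_nat (zcount ?fe (ball 0 s)) :: complex) = of_nat (zcount f (ball 0 s))"
    using main red[OF hfe nzfe fe_s] red[OF f nzf fs] by simp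
  then show ?thesis by (metis of_nat_eq_iff)
qed

text \<open>A finite value of \<open>disk_zeros\<close> means a finite zero set, which rules out the
  zero function because the disk is infinite.\<close>

lemma zcount_le_disk_zeros:
  assumes le: "disk_zeros f \<le> enat k" and s: "s < 1"
  shows "\<exists>z\<in>ball 0 1. f z \<noteq> 0" "zcount f (ball 0 s) \<le> k"
proof -
  have fin: "finite {z \<in> ball 0 1. f z = 0}" and
    sum: "(\<Sum>z \<in> {z \<in> ball 0 1. f z = 0}. nat (zorder f z)) \<le> k"
    using le by (auto simp: disk_zeros_def split: if_splits)
  show "\<exists>z\<in>ball 0 1. f z \<noteq> 0"
  proof (rule ccontr)
    assume "\<not> ?thesis"
    then have "{z \<in> ball 0 1. f z = 0} = ball 0 1" by auto
    moreover have "\<not> finite (ball (0::complex) 1)"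
      using finite_imp_not_open[of "ball (0::complex) 1"] by auto
    ultimately show False using fin by simp
  qed
  have "zcount f (ball 0 s) \<le> (\<Sum>z \<in> {z \<in> ball 0 1. f z = 0}. nat (zorder f z))"
    unfolding zcount_def by (rule sum_mono2[OF fin]) (use s in auto)
  then show "zcount f (ball 0 s) \<le> k" using sum by linarith
qed

subsection \<open>Power series converging in the disk\<close>

text \<open>Functions holomorphic in the disk are handled through their Taylor series at 0.
  Discarding negative powers after a division by \<open>z ^ d\<close> then becomes
  \<open>fps_shift d\<close>.\<close>

abbreviation disk_fps :: "complex fps \<Rightarrow> bool" where
  "disk_fps F \<equiv> 1 \<le> fps_conv_radius F"

lemma disk_fps_add: "disk_fps F \<Longrightarrow> disk_fps G \<Longrightarrow> disk_fps (F + G)"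
  and disk_fps_diff: "disk_fps F \<Longrightarrow> disk_fps G \<Longrightarrow> disk_fps (F - G)"
  and disk_fps_mult: "disk_fps F \<Longrightarrow> disk_fps G \<Longrightarrow> disk_fps (F * G)"
  using fps_conv_radius_add[of F G] fps_conv_radius_diff[of F G] fps_conv_radius_mult[of F G]
  by (auto simp: min_def split: if_splits intro: order_trans)

lemmas disk_fps_intros = disk_fps_add disk_fps_diff disk_fps_mult

lemma in_conv_radius: "disk_fps F \<Longrightarrow> norm z < 1 \<Longrightarrow> ereal (norm z) < fps_conv_radius F"
  by (metis ereal_less(3) order_less_le_trans)

lemma eval_disk_fps:
  assumes "norm z < 1" "disk_fps F" "disk_fps G"
  shows "eval_fps (F + G) z = eval_fps F z + eval_fps G z"
    "eval_fps (F - G) z = eval_fps F z - eval_fps G z"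
    "eval_fps (F * G) z = eval_fps F z * eval_fps G z"
  using assms by (auto intro!: eval_fps_add eval_fps_diff eval_fps_mult in_conv_radius)

lemma holomorphic_eval_disk_fps:
  assumes "disk_fps F"
  shows "eval_fps F holomorphic_on ball 0 1"
  using assms by (intro holomorphic_on_eval_fps) (auto simp: in_conv_radius)

lemma disk_fps_eqI:
  assumes "disk_fps F" "disk_fps G" "\<And>z. norm z < 1 \<Longrightarrow> eval_fps F z = eval_fps G z"
  shows "F = G"
proof (rule eval_fps_eqD)
  show "fps_conv_radius F > 0" "fps_conv_radius G > 0" 
    using assms(1,2) by (auto intro: less_le_trans[of _ 1])
  have "\<forall>\<^sub>F z in nhds (0::complex). z \<in> ball 0 1" by (intro eventually_nhds_in_open) auto
  then show "\<forall>\<^sub>F z in nhds 0. eval_fps F z = eval_fps G z"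
    by eventually_elim (use assms in auto)
qed

lemma fps_expansion_disk:
  assumes "h holomorphic_on ball 0 1"
  shows "disk_fps (fps_expansion h 0)" "\<And>z. norm z < 1 \<Longrightarrow> eval_fps (fps_expansion h 0) z = h z"
  using conv_radius_fps_expansion[of h 0 1] eval_fps_expansion'[of h 0 1] assms
  by (auto simp: one_ereal_def)

lemma fps_coeff_bound:
  assumes F: "disk_fps F" and s: "0 < s" "s < 1" and B: "\<And>z. norm z = s \<Longrightarrow> norm (eval_fps F z) \<le> B"
  shows "norm (fps_nth F k) \<le> B / s ^ k"
proof -
  have hol: "eval_fps F holomorphic_on ball 0 1" by (rule holomorphic_eval_disk_fps[OF F])
  have "norm ((deriv ^^ k) (eval_fps F) 0) \<le> fact k * B / s ^ k"
  proof (rule Cauchy_inequality)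
    show "eval_fps F holomorphic_on ball 0 s" by (rule holomorphic_on_subset[OF hol]) (use s in auto)
    show "continuous_on (cball 0 s) (eval_fps F)"
      by (rule continuous_on_subset[OF holomorphic_on_imp_continuous_on[OF hol]]) (use s in auto)
  qed (use s B in auto)
  then have "norm ((deriv ^^ k) (eval_fps F) 0) / fact k \<le> (fact k * B / s ^ k) / fact k"
    by (rule divide_right_mono) simp
  moreover have "fps_nth F k = (deriv ^^ k) (eval_fps F) 0 / fact k"
    using F by (intro fps_nth_conv_deriv) (auto intro: less_le_trans[of _ 1])
  ultimately show ?thesis by (simp add: norm_divide)
qed

lemma eval_fps_shift_bound:
  assumes F: "disk_fps F" and s: "0 < s" "s < 1" and B: "\<And>z. norm z = s \<Longrightarrow> norm (eval_fps F z) \<le> B"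
    and z: "norm z = s"
  shows "norm (eval_fps (fps_shift k F) z) \<le> 2 ^ k * B / s ^ k"
  using z
proof (induction k arbitrary: z)
  case 0
  then show ?case using B by simp
next
  case (Suc k)
  let ?H = "fps_shift k F"
  have H: "disk_fps ?H" using F by simp
  have H0: "norm (fps_nth ?H 0) \<le> 2 ^ k * B / s ^ k"
    using fps_coeff_bound[OF H s Suc.IH, of 0] by simp
  have dec: "?H = fps_X * fps_shift (Suc k) F + fps_const (fps_nth ?H 0)"
    by (auto simp: fps_eq_iff fps_X_mult_nth)
  have "eval_fps ?H z = z * eval_fps (fps_shift (Suc k) F) z + fps_nth ?H 0"
    using Suc.prems s F
    by (subst dec) (simp add: eval_disk_fps disk_fps_intros)
  then have "z * eval_fps (fps_shift (Suc k) F) z = eval_fps ?H z - fps_nth ?H 0" by simp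
  then have "s * norm (eval_fps (fps_shift (Suc k) F) z) \<le> norm (eval_fps ?H z) + norm (fps_nth ?H 0)"
    using Suc.prems by (metis norm_mult norm_triangle_ineq4)
  also have "\<dots> \<le> 2 ^ k * B / s ^ k + 2 ^ k * B / s ^ k" using H0 Suc.IH[OF Suc.prems] by linarith
  finally show ?case using s by (simp add: field_simps)
qed

lemma fps_eq_fps_of_polyI:
  fixes R :: "'a :: comm_monoid_add fps"
  assumes "\<And>k. k > n \<Longrightarrow> fps_nth R k = 0"
  obtains r where "degree r \<le> n" "R = fps_of_poly r"
proof -
  define r where "r = (\<Sum>i\<le>n. monom (fps_nth R i) i)"
  have c: "coeff r k = fps_nth R k" for k
    using assms[of k] by (cases "k \<le> n") (auto simp: r_def coeff_sum)
  show ?thesis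
    by (rule that[of r]) (auto simp: degree_le fps_eq_iff c assms)
qed

text \<open>A root of \<open>A\<close> lies in the disk, where the equation makes it a root of
  \<open>T\<close>; the common linear factor is cancelled and the degree of \<open>A\<close>
  drops.\<close>

lemma poly_dvd_if_continuous_quotient:
  fixes A T :: "complex poly"
  assumes "A \<noteq> 0" "\<And>z. poly A z = 0 \<Longrightarrow> norm z < 1" "continuous_on (ball 0 1) h"
    and "\<And>z. norm z < 1 \<Longrightarrow> poly A z * h z = poly T z"
  shows "A dvd T"
  using assms(1,2,4)
proof (induction "degree A" arbitrary: A T)
  case 0
  then show ?case by (metis is_unit_iff_degree unit_imp_dvd)
next
  case (Suc n)
  have "\<not> constant (poly A)" using Suc.hyps(2) by (simp add: constant_degree)
  then obtain a where a: "poly A a = 0" using fundamental_theorem_of_algebra by blast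
  then have na: "norm a < 1" by (rule Suc.prems(2))
  obtain B where B: "A = [:-a, 1:] * B" using a by (metis poly_eq_0_iff_dvd dvdE)
  have B0: "B \<noteq> 0" using B Suc.prems by auto
  have dB: "degree A = Suc (degree B)" using B B0 by (simp add: degree_mult_eq del: mult_pCons_left)
  have "poly T a = 0" using Suc.prems(3)[OF na] a by simp
  then obtain U where U: "T = [:-a, 1:] * U" by (metis poly_eq_0_iff_dvd dvdE)
  have eq: "poly B z * h z = poly U z" if "norm z < 1" "z \<noteq> a" for z
  proof -
    have "(z - a) * (poly B z * h z) = (z - a) * poly U z"
      using Suc.prems(3)[OF that(1)] by (simp add: B U algebra_simps)
    then show ?thesis using that(2) by simp
  qed
  \<comment> \<open>Cancelling \<open>z - a\<close> loses the point \<open>a\<close> itself;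
    continuity of \<open>h\<close> recovers it.\<close>
  have eq_a: "poly B a * h a = poly U a"
  proof -
    have ca: "isCont (\<lambda>z. poly B z * h z - poly U z) a"
      using assms(3) na by (intro continuous_intros)
        (metis continuous_on_interior interior_ball mem_ball_0)
    have "\<forall>\<^sub>F z in at a. z \<in> ball 0 1" using na by (intro eventually_at_in_open') auto
    moreover have "\<forall>\<^sub>F z in at a. z \<noteq> a" by (metis eventually_neq_at_within)
    ultimately have "\<forall>\<^sub>F z in at a. poly B z * h z - poly U z = 0"
      by eventually_elim (use eq in auto)
    then have "(\<lambda>z. poly B z * h z - poly U z) \<midarrow>a\<rightarrow> 0" by (rule tendsto_eventually)
    then show ?thesis using ca by (metis (no_types, lifting) LIM_unique isCont_def right_minus_eq)
  qed
  have "B dvd U"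
    by (rule Suc.hyps(1)) (use Suc.hyps(2) dB B0 eq eq_a Suc.prems(2) in \<open>auto simp: B\<close>)
  then show ?case unfolding B U by (rule mult_dvd_mono[OF dvd_refl])
qed

subsection \<open>The function class and its closure property\<close>

text \<open>Counting in smaller balls keeps the zero sets finite. The first conjunct is essential:
  \<open>zcount\<close> of the zero function is 0 on balls of positive radius, its zero set there
  being infinite.\<close>

definition few_zeros :: "nat \<Rightarrow> (complex \<Rightarrow> complex) \<Rightarrow> bool" where
  "few_zeros k f \<longleftrightarrow> (\<exists>z\<in>ball 0 1. f z \<noteq> 0) \<and> (\<forall>s<1. zcount f (ball 0 s) \<le> k)"

lemma few_zeros_cong:
  assumes "\<And>z. norm z < 1 \<Longrightarrow> f z = g z"
  shows "few_zeros k f \<longleftrightarrow> few_zeros k g"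
proof -
  have "zcount f (ball 0 s) = zcount g (ball 0 s)" if "s < 1" for s
    using assms that by (intro zcount_cong) auto
  then show ?thesis unfolding few_zeros_def using assms by auto
qed

text \<open>The class \<open>C m\<close> of the overview, with functions replaced by their Taylor
  series.\<close>

definition fps_class :: "nat \<Rightarrow> complex fps set" where
  "fps_class m = {F. disk_fps F \<and>
     (\<forall>n p. degree p \<le> n \<longrightarrow> few_zeros (m + n) (\<lambda>z. z ^ n * eval_fps F z + poly p z))}"

lemma fps_classD:
  assumes "F \<in> fps_class m"
  shows "disk_fps F"
    "degree p \<le> n \<Longrightarrow> few_zeros (m + n) (\<lambda>z. z ^ n * eval_fps F z + poly p z)"
  using assms by (auto simp: fps_class_def)

text \<open>Multiplied by \<open>z ^ n\<close>, the constant becomes a monomial of degree at most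
  \<open>n\<close> and is absorbed into \<open>p\<close>.\<close>

lemma fps_class_add_const:
  assumes F: "F \<in> fps_class m"
  shows "F + fps_const c \<in> fps_class m"
  unfolding fps_class_def
proof (intro CollectI conjI allI impI)
  show "disk_fps (F + fps_const c)" using fps_classD(1)[OF F] by (intro disk_fps_intros) auto
  fix n and p :: "complex poly" assume p: "degree p \<le> n"
  have "degree (p + monom c n) \<le> n" using p degree_monom_le[of c n] by (intro degree_add_le) auto
  from fps_classD(2)[OF F this] have "few_zeros (m + n) (\<lambda>z. z ^ n * eval_fps F z + poly (p + monom c n) z)" .
  then show "few_zeros (m + n) (\<lambda>z. z ^ n * eval_fps (F + fps_const c) z + poly p z)"
    by (rule iffD1[OF few_zeros_cong, rotated])
      (use fps_classD(1)[OF F] in \<open>auto simp: eval_disk_fps poly_monom algebra_simps\<close>)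
qed

section \<open>Tools for the closure property: zero-free circles and geometric sums\<close>

lemma exists_radius_nonzero:
  assumes f: "f holomorphic_on ball 0 1" and nz: "\<exists>z\<in>ball 0 1. f z \<noteq> (0::complex)" and s: "s < 1"
  obtains t where "s < t" "t < 1" "\<And>z. norm z = t \<Longrightarrow> f z \<noteq> 0"
proof -
  obtain u where u: "s < u" "u < 1" using s dense by blast
  have "finite (norm ` {z \<in> cball 0 u. f z = 0})"
    using finite_zeros_cball[OF f nz u(2)] by simp
  moreover have "infinite {s<..<u}" using u by (simp add: infinite_Ioo)
  ultimately obtain t where t: "t \<in> {s<..<u}" "t \<notin> norm ` {z \<in> cball 0 u. f z = 0}"
    by (metis (no_types, lifting) finite_subset subsetI)
  show ?thesis by (rule that[of t]) (use t u in auto)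
qed

text \<open>This is \<open>z ^ (d * N)\<close> times the partial sum, up to exponent
  \<open>N\<close>, of the geometric series of \<open>- Y / z ^ d\<close>.\<close>

definition geometric_poly :: "nat \<Rightarrow> complex poly \<Rightarrow> nat \<Rightarrow> complex poly" where
  "geometric_poly d Y N = (\<Sum>i<Suc N. monom 1 d ^ i * (- Y) ^ (N - i))"

text \<open>Outside radius \<open>s0\<close> the modulus of \<open>Y\<close> is strictly below that
  of \<open>z ^ d\<close>. Hence neither \<open>A\<close> nor
  \<open>z ^ (d * Suc N) - (- Y) ^ Suc N\<close>, which is a multiple of \<open>W N\<close>, can
  vanish there.\<close>

lemma geometric_poly_facts:
  fixes Y :: "complex poly"
  assumes Y: "degree Y < d" and q: "q < 1" and s0: "0 < s0" "s0 < 1"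
    and Yq: "\<forall>z. s0 \<le> norm z \<longrightarrow> norm (poly Y z) \<le> q * norm z ^ d"
  defines "A \<equiv> monom 1 d + Y"
  defines "W \<equiv> geometric_poly d Y"
  shows "degree A = d" "A \<noteq> 0" "\<And>z. poly A z = 0 \<Longrightarrow> norm z < s0"
    "\<And>N. W N * A = monom 1 (d * Suc N) - (- Y) ^ Suc N"
    "\<And>N. degree (W N) = d * N" "\<And>N. W N \<noteq> 0" "\<And>N z. poly (W N) z = 0 \<Longrightarrow> norm z < s0"
proof -
  have dA: "degree A = d" unfolding A_def using Y by (simp add: degree_add_eq_left degree_monom_eq)
  moreover have A0: "A \<noteq> 0" using dA Y by auto
  ultimately show "degree A = d" "A \<noteq> 0" by auto
  have strict: "norm (poly Y z) < norm z ^ d" if "s0 \<le> norm z" for z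
  proof -
    have "0 < norm z ^ d" using that s0 by (intro zero_less_power) linarith
    then have "q * norm z ^ d < norm z ^ d" using q by simp
    then show ?thesis using Yq[rule_format, OF that] by linarith
  qed
  show "norm z < s0" if "poly A z = 0" for z
  proof (rule ccontr)
    assume "\<not> ?thesis"
    then have "norm (poly Y z) < norm z ^ d" using strict by simp
    moreover have "poly Y z = - (z ^ d)"
      using that by (simp add: A_def poly_monom add_eq_0_iff2)
    ultimately show False by (simp add: norm_power)
  qed
  show WA: "W N * A = monom 1 (d * Suc N) - (- Y) ^ Suc N" for N
  proof -
    have "monom 1 d ^ Suc N - (- Y) ^ Suc N = (monom 1 d - (- Y)) * W N"
      unfolding W_def geometric_poly_def by (rule diff_power_eq_sum)
    moreover have "monom 1 d ^ Suc N = monom (1::complex) (d * Suc N)"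
      by (simp add: monom_power mult.commute del: power_Suc)
    ultimately show ?thesis by (simp only: A_def diff_minus_eq_add mult.commute[of "W N"])
  qed
  have dR: "degree (monom 1 (d * Suc N) - (- Y) ^ Suc N) = d * Suc N" for N
  proof -
    have "degree ((- Y) ^ Suc N) \<le> degree Y * Suc N" by (metis degree_minus degree_power_le)
    also have "\<dots> < d * Suc N" using Y by (intro mult_strict_right_mono) auto
    finally show ?thesis
      by (subst diff_conv_add_uminus, subst degree_add_eq_left) (auto simp: degree_monom_eq)
  qed
  have W0: "W N \<noteq> 0" for N
  proof
    assume "W N = 0"
    then have "monom 1 (d * Suc N) - (- Y) ^ Suc N = 0" using WA[of N] by simp
    then have "d * Suc N = 0" using dR[of N] by (metis degree_0)
    then show False using Y by simp
  qed
  then show "W N \<noteq> 0" for N .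
  show "degree (W N) = d * N" for N
    using WA[of N] dR[of N] degree_mult_eq[OF W0[of N] A0] dA by simp
  show "norm z < s0" if "poly (W N) z = 0" for N z
  proof (rule ccontr)
    assume "\<not> ?thesis"
    then have s: "norm (poly Y z) < norm z ^ d" using strict by simp
    have "poly (W N * A) z = 0" using that by simp
    then have "(z ^ d) ^ Suc N = (- poly Y z) ^ Suc N"
      by (simp only: WA poly_diff poly_monom poly_power poly_minus power_mult mult_1 right_minus_eq)
    then have "norm ((z ^ d) ^ Suc N) = norm ((- poly Y z) ^ Suc N)" by (rule arg_cong)
    then have "(norm z ^ d) ^ Suc N = norm (poly Y z) ^ Suc N" by (simp only: norm_power norm_minus_cancel)
    then have "norm z ^ d = norm (poly Y z)"
      by (rule power_inject_base) auto
    then show False using s by simp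
  qed
qed

text \<open>After multiplication by \<open>fps_X ^ d\<close> each shift is a product minus its
  cutoff, a polynomial of degree below \<open>d\<close>. The products cancel by \<open>WA\<close>,
  and only the cutoffs, one of them multiplied by \<open>W\<close>, remain.\<close>

lemma fps_shift_poly_identity:
  fixes F :: "complex fps" and Y W :: "complex poly"
  assumes Y: "degree Y < d" and W: "degree W \<le> d * N"
    and WA: "W * (monom 1 d + Y) = monom 1 (d * Suc N) - (- Y) ^ Suc N"
  obtains r where "degree r \<le> d * N"
    "fps_of_poly W * (F + fps_shift d (fps_of_poly Y * F)) + fps_shift d (fps_of_poly ((- Y) ^ Suc N) * F)
      = fps_X ^ (d * N) * F - fps_of_poly r"
proof -
  let ?T = "fps_of_poly Y * F" and ?T' = "fps_of_poly ((- Y) ^ Suc N) * F"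
  let ?W = "fps_of_poly W"
  define R where "R = fps_X ^ (d * N) * F - (?W * (F + fps_shift d ?T) + fps_shift d ?T')"
  have d: "d \<ge> 1" using Y by simp
  obtain c where c: "degree c \<le> d - 1" "fps_cutoff d ?T = fps_of_poly c"
    by (rule fps_eq_fps_of_polyI[of "d - 1" "fps_cutoff d ?T"]) auto
  obtain c' where c': "degree c' \<le> d - 1" "fps_cutoff d ?T' = fps_of_poly c'"
    by (rule fps_eq_fps_of_polyI[of "d - 1" "fps_cutoff d ?T'"]) auto
  have T: "fps_X ^ d * fps_shift d ?T = ?T - fps_of_poly c"
    using fps_shift_cutoff'[of d ?T] c(2) by (simp add: eq_diff_eq)
  have T': "fps_X ^ d * fps_shift d ?T' = ?T' - fps_of_poly c'"
    using fps_shift_cutoff'[of d ?T'] c'(2) by (simp add: eq_diff_eq)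
  have "?W * (fps_X ^ d + fps_of_poly Y) = fps_of_poly (W * (monom 1 d + Y))"
    by (simp add: fps_of_poly_mult fps_of_poly_add fps_of_poly_monom')
  also have "\<dots> = fps_X ^ (d * Suc N) - fps_of_poly ((- Y) ^ Suc N)"
    by (simp only: WA fps_of_poly_diff fps_of_poly_monom')
  finally have WA': "?W * (fps_X ^ d + fps_of_poly Y) = fps_X ^ (d * Suc N) - fps_of_poly ((- Y) ^ Suc N)" .
  have "fps_X ^ d * R = fps_X ^ (d * Suc N) * F - (?W * (fps_X ^ d * F + fps_X ^ d * fps_shift d ?T) + fps_X ^ d * fps_shift d ?T')"
    unfolding R_def by (simp add: algebra_simps power_add)
  also have "\<dots> = fps_X ^ (d * Suc N) * F - (?W * (fps_X ^ d + fps_of_poly Y) * F - ?W * fps_of_poly c + ?T' - fps_of_poly c')"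
    unfolding T T' by (simp add: algebra_simps)
  also have "\<dots> = fps_of_poly (W * c + c')"
    unfolding WA' by (simp add: algebra_simps fps_of_poly_mult fps_of_poly_add)
  finally have XR: "fps_X ^ d * R = fps_of_poly (W * c + c')" .
  have "degree (W * c + c') \<le> d * N + (d - 1)"
    using degree_mult_le[of W c] W c(1) c'(1) by (intro degree_add_le) auto
  then have "fps_nth R k = 0" if "k > d * N" for k
  proof -
    have "fps_nth R k = fps_nth (fps_X ^ d * R) (k + d)" by (simp add: fps_X_power_mult_nth)
    also have "\<dots> = 0"
      unfolding XR fps_of_poly_nth
      by (rule coeff_eq_0) (use \<open>degree (W * c + c') \<le> _\<close> that d in linarith)
    finally show ?thesis .
  qed
  then obtain r where "degree r \<le> d * N" "R = fps_of_poly r"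
    using fps_eq_fps_of_polyI[of "d * N" R] by blast
  then show ?thesis by (intro that[of r]) (auto simp: R_def algebra_simps)
qed


lemma fps_class_nonconst:
  assumes "F \<in> fps_class m"
  shows "\<exists>z\<in>ball 0 1. eval_fps F z \<noteq> c"
proof -
  have "few_zeros (m + 0) (\<lambda>z. z ^ 0 * eval_fps F z + poly [:-c:] z)"
    by (rule fps_classD(2)[OF assms]) simp
  then show ?thesis by (auto simp: few_zeros_def)
qed

text \<open>Otherwise \<open>F + S\<close> is a constant \<open>c\<close>, and
  \<open>A * (F - c)\<close> is a polynomial of degree below \<open>d\<close>. All roots of
  \<open>A\<close> lie in the disk, so \<open>A\<close>, of degree \<open>d\<close>, divides that
  polynomial. It is therefore 0 and \<open>F\<close> is constant, which the class excludes.\<close>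

lemma fps_class_closed_nonzero:
  assumes F: "F \<in> fps_class m" and Y: "degree Y < d" and q: "q < 1" and s0: "0 < s0" "s0 < 1"
    and Yq: "\<forall>z. s0 \<le> norm z \<longrightarrow> norm (poly Y z) \<le> q * norm z ^ d" and p: "degree p \<le> n"
  defines "S \<equiv> fps_shift d (fps_of_poly Y * F)"
  shows "\<exists>z\<in>ball 0 1. z ^ n * eval_fps (F + S) z + poly p z \<noteq> 0"
proof (rule ccontr)
  assume neg: "\<not> ?thesis"
  define A where "A = monom 1 d + Y"
  note facts = geometric_poly_facts(1-3)[OF Y q s0 Yq, folded A_def]
  note FD = fps_classD(1)[OF F]
  have SD: "disk_fps S" unfolding S_def using FD by (simp add: disk_fps_mult)
  have "fps_X ^ n * (F + S) = fps_of_poly (- p)"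
    using neg FD SD by (intro disk_fps_eqI)
      (auto simp: disk_fps_intros eval_disk_fps add_eq_0_iff2)
  then have "fps_nth (F + S) k = - coeff p (k + n)" for k
    by (metis (no_types) fps_X_power_mult_nth add_diff_cancel_right' coeff_minus fps_of_poly_nth not_add_less2)
  then have "fps_nth (F + S) k = 0" if "k > 0" for k
    using p that by (simp add: coeff_eq_0)
  then have FS: "F + S = fps_const (fps_nth (F + S) 0)"
    by (intro fps_ext) auto
  define c where "c = fps_nth (F + S) 0"
  obtain t where t: "degree t \<le> d - 1" "fps_cutoff d (fps_of_poly Y * F) = fps_of_poly t"
    by (rule fps_eq_fps_of_polyI[of "d - 1" "fps_cutoff d (fps_of_poly Y * F)"]) auto
  have "fps_X ^ d * S = fps_of_poly Y * F - fps_of_poly t"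
    using fps_shift_cutoff'[of d "fps_of_poly Y * F"] t(2) by (simp add: S_def eq_diff_eq)
  then have YF: "fps_of_poly Y * F = fps_X ^ d * S + fps_of_poly t" by simp
  have XFS: "fps_X ^ d * (F + S) = fps_X ^ d * fps_const c" unfolding c_def using FS by (rule arg_cong)
  have "fps_of_poly A * (F - fps_const c)
      = fps_X ^ d * F + fps_of_poly Y * F - fps_X ^ d * fps_const c - fps_const c * fps_of_poly Y"
    by (simp add: A_def algebra_simps fps_of_poly_add fps_of_poly_monom')
  also have "\<dots> = fps_of_poly (t - smult c Y)"
    unfolding YF XFS[symmetric] by (simp add: algebra_simps fps_of_poly_diff fps_of_poly_smult)
  finally have *: "fps_of_poly A * (F - fps_const c) = fps_of_poly (t - smult c Y)" .
  have "A dvd t - smult c Y"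
  proof (rule poly_dvd_if_continuous_quotient[of _ "\<lambda>z. eval_fps F z - c"])
    show "continuous_on unit_disk (\<lambda>z. eval_fps F z - c)"
      using FD by (intro continuous_intros holomorphic_on_imp_continuous_on holomorphic_eval_disk_fps)
    show "norm z < 1" if "poly A z = 0" for z using facts(3)[OF that] s0 by simp
    show "poly A z * (eval_fps F z - c) = poly (t - smult c Y) z" if "norm z < 1" for z
      using arg_cong[OF *, of "\<lambda>H. eval_fps H z"] that FD
      by (simp add: eval_disk_fps disk_fps_intros)
  qed (rule facts(2))
  moreover have "degree (t - smult c Y) < d"
    using t(1) Y by (intro degree_diff_less) auto
  ultimately have "t - smult c Y = 0"
    using facts(1) dvd_imp_degree_le by force
  then have "fps_of_poly A * (F - fps_const c) = 0" using * by simp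
  moreover have "fps_of_poly A \<noteq> 0" using facts(2) by (metis fps_of_poly_0 fps_of_poly_eq_iff)
  ultimately have "F = fps_const c" by simp
  then show False using fps_class_nonconst[OF F, of c] by auto
qed

text \<open>Writing \<open>S\<close> for the added shift, \<open>F + S\<close> consists of the nonnegative powers in \<open>(1 + Y / z ^ d) * F\<close>. With \<open>W\<close> the geometric sum
  approximating \<open>z ^ (d * N) / (1 + Y / z ^ d)\<close>, the function \<open>W * (F + S)\<close> differs from
  \<open>z ^ (d * N) * F\<close> by a polynomial of degree at most \<open>d * N\<close> and an error that is negligible on a
  circle; Rouche's theorem and the \<open>d * N\<close> zeros of \<open>W\<close> then bound the zeros of the rest.\<close>

lemma fps_class_closed:
  assumes F: "F \<in> fps_class m" and Y: "degree Y < d" and q: "q < 1" "0 \<le> q" and s0: "0 < s0" "s0 < 1"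
    and Yq: "\<forall>z. s0 \<le> norm z \<longrightarrow> norm (poly Y z) \<le> q * norm z ^ d"
  shows "F + fps_shift d (fps_of_poly Y * F) \<in> fps_class m"
  unfolding fps_class_def
proof (intro CollectI conjI allI impI)
  define S where "S = fps_shift d (fps_of_poly Y * F)"
  define A where "A = monom 1 d + Y"
  define W where "W = geometric_poly d Y"
  note facts = geometric_poly_facts[OF Y q(1) s0 Yq, folded A_def W_def]
  note FD = fps_classD(1)[OF F]
  have SD: "disk_fps S" unfolding S_def using FD by (simp add: disk_fps_mult)
  show "disk_fps (F + fps_shift d (fps_of_poly Y * F))"
    using FD SD unfolding S_def by (rule disk_fps_add)
  fix n and p :: "complex poly" assume p: "degree p \<le> n"
  define G where "G = (\<lambda>z. z ^ n * eval_fps (F + S) z + poly p z)"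
  have G: "G holomorphic_on ball 0 1"
    unfolding G_def using FD SD by (intro holomorphic_intros holomorphic_eval_disk_fps disk_fps_intros)
  have nz: "\<exists>z\<in>ball 0 1. G z \<noteq> 0"
    unfolding G_def S_def by (rule fps_class_closed_nonzero[OF F Y q(1) s0 Yq p])
  have "zcount G (ball 0 t) \<le> m + n" if "t < 1" for t
  proof -
    have "max t s0 < 1" using that s0 by simp
    then obtain s where s: "max t s0 < s" "s < 1" and Gs: "\<And>z. norm z = s \<Longrightarrow> G z \<noteq> 0"
      using exists_radius_nonzero[OF G nz] by blast
    have s': "0 < s" "s0 < s" "t < s" using s s0 by auto
    have csp: "compact (sphere (0::complex) s)" "sphere (0::complex) s \<noteq> {}" using s' by auto
    have sub: "sphere 0 s \<subseteq> ball (0::complex) 1" using s by auto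
    obtain z0 where z0: "norm z0 = s" "\<And>z. norm z = s \<Longrightarrow> norm (G z0) \<le> norm (G z)"
      using continuous_attains_inf[OF csp continuous_on_norm, of "\<lambda>z. G z"]
        continuous_on_subset[OF holomorphic_on_imp_continuous_on[OF G] sub]
      by auto
    obtain z1 where z1: "norm z1 = s" "\<And>z. norm z = s \<Longrightarrow> norm (eval_fps F z) \<le> norm (eval_fps F z1)"
      using continuous_attains_sup[OF csp continuous_on_norm, of "\<lambda>z. eval_fps F z"]
        continuous_on_subset[OF holomorphic_on_imp_continuous_on[OF holomorphic_eval_disk_fps[OF FD]] sub]
      by auto
    define c where "c = norm (G z0)"
    define M where "M = norm (eval_fps F z1)"
    have c: "c > 0" using Gs z0 by (simp add: c_def)
    \<comment> \<open>\<open>N\<close> is chosen so that on the circle the error bound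
      \<open>2 ^ d * M * q ^ Suc N * s ^ (d * N)\<close> falls below
      \<open>c * (1 - q) / 2 * s ^ (d * N)\<close>, a lower bound for the modulus of
      \<open>W N * G\<close>.\<close>
    have "(\<lambda>N. 2 ^ d * M * q ^ N) \<longlonglongrightarrow> 2 ^ d * M * 0"
      using q by (intro tendsto_intros LIMSEQ_realpow_zero) auto
    then have "\<forall>\<^sub>F N in sequentially. 2 ^ d * M * q ^ N < c * (1 - q) / 2"
      by (rule order_tendstoD) (use c q in auto)
    then obtain N where N: "2 ^ d * M * q ^ Suc N < c * (1 - q) / 2"
      by (auto simp: eventually_sequentially intro: le_SucI)
    define S' where "S' = fps_shift d (fps_of_poly ((- Y) ^ Suc N) * F)"
    have S'D: "disk_fps S'" unfolding S'_def using FD by (simp add: disk_fps_mult)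
    have S'b: "norm (eval_fps S' z) \<le> 2 ^ d * M * q ^ Suc N * s ^ (d * N)" if z: "norm z = s" for z
    proof -
      have "norm (eval_fps (fps_of_poly ((- Y) ^ Suc N) * F) w) \<le> (q * s ^ d) ^ Suc N * M" if w: "norm w = s" for w
      proof -
        have "norm (poly Y w) ^ Suc N \<le> (q * s ^ d) ^ Suc N"
          using Yq[rule_format, of w] w s' by (intro power_mono) auto
        then have "norm (poly Y w) ^ Suc N * norm (eval_fps F w) \<le> (q * s ^ d) ^ Suc N * M"
          using z1(2)[OF w] q(2) s' unfolding M_def by (intro mult_mono) auto
        moreover have "eval_fps (fps_of_poly ((- Y) ^ Suc N) * F) w = (- poly Y w) ^ Suc N * eval_fps F w"
          using w s FD by (subst eval_disk_fps) (auto simp: poly_power)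
        ultimately show ?thesis by (simp add: norm_mult norm_power)
      qed
      from eval_fps_shift_bound[OF _ s'(1) s(2) this z, of d]
      have "norm (eval_fps S' z) \<le> 2 ^ d * ((q * s ^ d) ^ Suc N * M) / s ^ d"
        unfolding S'_def using FD by (simp add: disk_fps_mult)
      also have "\<dots> = 2 ^ d * M * q ^ Suc N * s ^ (d * N)"
        using s' by (simp add: power_mult_distrib field_simps flip: power_mult)
      finally show ?thesis .
    qed
    \<comment> \<open>\<open>W N\<close> is estimated through its product with \<open>A\<close>: the
      product is at least \<open>(1 - q) * (s ^ d) ^ Suc N\<close> in modulus, while
      \<open>A\<close> is at most \<open>2 * s ^ d\<close>.\<close>
    have Wb: "s ^ (d * N) * (1 - q) / 2 \<le> norm (poly (W N) z)" if z: "norm z = s" for z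
    proof -
      have "poly (W N) z * poly A z = (z ^ d) ^ Suc N - (- poly Y z) ^ Suc N"
        using arg_cong[OF facts(4)[of N], of "\<lambda>p. poly p z"]
        by (simp only: poly_mult poly_diff poly_monom poly_power poly_minus power_mult) simp
      then have "norm (poly (W N) z) * norm (poly A z) \<ge> norm ((z ^ d) ^ Suc N) - norm ((- poly Y z) ^ Suc N)"
        by (metis norm_mult norm_triangle_ineq2)
      moreover have "norm ((- poly Y z) ^ Suc N) \<le> (q * s ^ d) ^ Suc N"
        unfolding norm_power norm_minus_cancel using Yq[rule_format, of z] z s' by (intro power_mono) auto
      moreover have "(q * s ^ d) ^ Suc N \<le> q * (s ^ d) ^ Suc N"
      proof -
        have "q ^ Suc N \<le> q" using q power_decreasing[of 1 "Suc N" q] by simp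
        then show ?thesis unfolding power_mult_distrib using s' by (intro mult_right_mono) auto
      qed
      moreover have "norm ((z ^ d) ^ Suc N) = (s ^ d) ^ Suc N" by (simp only: norm_power z)
      ultimately have 1: "norm (poly (W N) z) * norm (poly A z) \<ge> (1 - q) * (s ^ d) ^ Suc N"
        unfolding left_diff_distrib mult_1 by linarith
      have "norm (poly A z) \<le> norm (z ^ d) + norm (poly Y z)"
        unfolding A_def by (simp add: poly_monom norm_triangle_ineq)
      also have "\<dots> \<le> 2 * s ^ d"
      proof -
        have "q * s ^ d \<le> 1 * s ^ d" using q s' by (intro mult_right_mono) auto
        moreover have "norm (poly Y z) \<le> q * s ^ d" using Yq[rule_format, of z] z s' by simp
        ultimately have "norm (poly Y z) \<le> 1 * s ^ d" by (rule order_trans[rotated])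
        then show ?thesis using z by (simp add: norm_power)
      qed
      finally have "norm (poly (W N) z) * norm (poly A z) \<le> norm (poly (W N) z) * (2 * s ^ d)"
        by (intro mult_left_mono) auto
      then have "(1 - q) * (s ^ d) ^ N * s ^ d \<le> norm (poly (W N) z) * 2 * s ^ d" using 1 by (simp add: algebra_simps)
      then have "(1 - q) * (s ^ d) ^ N \<le> norm (poly (W N) z) * 2"
        using s' by (simp add: mult_le_cancel_right)
      then show ?thesis by (simp add: mult.commute[of _ "1 - q"] flip: power_mult)
    qed
    obtain r where r: "degree r \<le> d * N" "fps_of_poly (W N) * (F + S) + S' = fps_X ^ (d * N) * F - fps_of_poly r"
      using fps_shift_poly_identity[OF Y, of "W N" N F] facts(4,5)[of N] unfolding A_def S_def S'_def by auto
    \<comment> \<open>With this polynomial \<open>z ^ (d * N + n) * F + pN\<close> equals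
      \<open>W N * G + z ^ n * S'\<close>, so the hypothesis on \<open>F\<close> bounds the zeros of
      the right-hand side.\<close>
    define pN where "pN = W N * p - monom 1 n * r"
    have "degree pN \<le> d * N + n"
    proof -
      have "degree (W N * p) \<le> d * N + n" using degree_mult_le[of "W N" p] facts(5)[of N] p by simp
      moreover have "degree (monom 1 n * r) \<le> d * N + n"
        using degree_mult_le[of "monom 1 n" r] r(1) degree_monom_le[of "1::complex" n] by linarith
      ultimately show ?thesis unfolding pN_def by (rule degree_diff_le)
    qed
    then have few: "few_zeros (m + (d * N + n)) (\<lambda>z. z ^ (d * N + n) * eval_fps F z + poly pN z)"
      by (rule fps_classD(2)[OF F])
    have eq: "z ^ (d * N + n) * eval_fps F z + poly pN z = poly (W N) z * G z + z ^ n * eval_fps S' z"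
      if "norm z < 1" for z
    proof -
      have "poly (W N) z * eval_fps (F + S) z + eval_fps S' z = z ^ (d * N) * eval_fps F z - poly r z"
        using arg_cong[OF r(2), of "\<lambda>H. eval_fps H z"] that FD SD S'D
        by (simp add: eval_disk_fps disk_fps_intros)
      then have "z ^ (d * N) * eval_fps F z = poly (W N) z * eval_fps (F + S) z + eval_fps S' z + poly r z"
        by simp
      then have "z ^ n * (z ^ (d * N) * eval_fps F z) = z ^ n * (poly (W N) z * eval_fps (F + S) z + eval_fps S' z + poly r z)"
        by simp
      then show ?thesis by (simp add: pN_def G_def poly_monom power_add algebra_simps)
    qed
    have "zcount (\<lambda>z. poly (W N) z * G z + z ^ n * eval_fps S' z) (ball 0 s) = zcount (\<lambda>z. poly (W N) z * G z) (ball 0 s)"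
    proof (rule Rouche_circle[OF _ _ s'(1) s(2)])
      show "(\<lambda>z. poly (W N) z * G z) holomorphic_on ball 0 1" using G by (intro holomorphic_intros)
      show "(\<lambda>z. z ^ n * eval_fps S' z) holomorphic_on ball 0 1"
        using S'D by (intro holomorphic_intros holomorphic_eval_disk_fps)
      fix z :: complex assume z: "norm z = s"
      have "norm (z ^ n * eval_fps S' z) = s ^ n * norm (eval_fps S' z)" using z by (simp add: norm_mult norm_power)
      also have "\<dots> \<le> 1 * norm (eval_fps S' z)" using s s' by (intro mult_right_mono power_le_one) auto
      also have "\<dots> \<le> 2 ^ d * M * q ^ Suc N * s ^ (d * N)" using S'b[OF z] by simp
      also have "\<dots> < c * (1 - q) / 2 * s ^ (d * N)" using N s' by (intro mult_strict_right_mono) auto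
      also have "\<dots> = (s ^ (d * N) * (1 - q) / 2) * c" by simp
      also have "\<dots> \<le> norm (poly (W N) z) * norm (G z)"
        using Wb[OF z] z0(2)[OF z] c unfolding c_def by (intro mult_mono) auto
      finally show "norm (z ^ n * eval_fps S' z) < norm (poly (W N) z * G z)" by (simp add: norm_mult)
    qed
    also have "\<dots> = d * N + zcount G (ball 0 s)"
      using zcount_poly_times[OF G nz s(2) facts(6)[of N]] facts(7)[of N] facts(5)[of N] s' by force
    finally have "zcount (\<lambda>z. z ^ (d * N + n) * eval_fps F z + poly pN z) (ball 0 s) = d * N + zcount G (ball 0 s)"
      using zcount_cong[of "ball 0 s" "\<lambda>z. z ^ (d * N + n) * eval_fps F z + poly pN z"] eq s(2) by force
    moreover have "zcount (\<lambda>z. z ^ (d * N + n) * eval_fps F z + poly pN z) (ball 0 s) \<le> m + (d * N + n)"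
      using few s(2) unfolding few_zeros_def by blast
    ultimately have "zcount G (ball 0 s) \<le> m + n" by linarith
    moreover have "zcount G (ball 0 t) \<le> zcount G (ball 0 s)"
      using zcount_mono[OF G nz, of t s] s s' by simp
    ultimately show ?thesis by linarith
  qed
  then show "few_zeros (m + n) (\<lambda>z. z ^ n * eval_fps (F + fps_shift d (fps_of_poly Y * F)) z + poly p z)"
    using nz unfolding few_zeros_def G_def S_def by blast
qed

subsection \<open>Bounds for the reciprocal\<close>

text \<open>Apply the Schwarz lemma to \<open>f / (2 * M - f)\<close>, rescaled to the unit disk.\<close>

lemma Borel_Caratheodory:
  assumes f: "f holomorphic_on ball 0 s" "f 0 = 0" and M: "\<And>z. norm z < s \<Longrightarrow> Re (f z) < M"
    and z: "norm z < s"
  shows "norm (f z) \<le> 2 * M * norm z / (s - norm z)"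
proof -
  have s: "0 < s" using z norm_ge_zero[of z] by linarith
  have M0: "0 < M" using M[of 0] f(2) s by simp
  define h where "h = (\<lambda>w. f (of_real s * w) / (2 * of_real M - f (of_real s * w)))"
  have sw: "norm (of_real s * w) < s" if "norm w < 1" for w :: complex
    using that s by (simp add: norm_mult)
  have lt: "norm (f u) < norm (2 * of_real M - f u)" if "norm u < s" for u
  proof -
    \<comment> \<open>The quantity is the difference of the two squared moduli below.\<close>
    have "0 < 4 * M * (M - Re (f u))" using M[OF that] M0 by simp
    then have "(norm (f u))\<^sup>2 < (norm (2 * of_real M - f u))\<^sup>2"
      unfolding cmod_power2 by (simp add: power2_eq_square algebra_simps)
    then show ?thesis by (rule power2_less_imp_less) simp
  qed
  have "norm (h (z / of_real s)) \<le> norm (z / of_real s)"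
  proof (rule Schwarz_Lemma(1))
    have "(\<lambda>w. f (of_real s * w)) holomorphic_on ball 0 1"
      by (rule holomorphic_on_compose_gen[of "\<lambda>w. of_real s * w" "ball 0 1" f "ball 0 s", unfolded o_def])
        (use f(1) sw in \<open>auto intro!: holomorphic_intros\<close>)
    moreover have "2 * of_real M - f (of_real s * w) \<noteq> 0" if "w \<in> ball 0 1" for w
      using lt[OF sw[of w]] that by auto
    ultimately show "h holomorphic_on ball 0 1" unfolding h_def by (intro holomorphic_intros) auto
    show "h 0 = 0" by (simp add: h_def f(2))
    show "norm (h w) < 1" if "norm w < 1" for w
    proof -
      have "norm (f (of_real s * w)) < norm (2 * of_real M - f (of_real s * w))" by (rule lt[OF sw[OF that]])
      then show ?thesis by (simp add: h_def norm_divide divide_less_eq_1)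
    qed
    show "norm (z / of_real s) < 1" using z s by (simp add: norm_divide)
  qed
  moreover have "of_real s * (z / of_real s) = z" using s by simp
  ultimately have "norm (f z) / norm (2 * of_real M - f z) \<le> norm z / s"
    using s by (simp add: h_def norm_divide)
  moreover have "0 < norm (2 * of_real M - f z)" using lt[OF z] norm_ge_zero[of "f z"] by linarith
  ultimately have "norm (f z) * s \<le> norm z * norm (2 * of_real M - f z)"
    using s by (simp add: field_simps)
  also have "\<dots> \<le> norm z * (2 * M + norm (f z))"
    using norm_triangle_ineq4[of "2 * of_real M" "f z"] M0 by (intro mult_left_mono) (auto simp: norm_mult)
  finally show ?thesis using z by (simp add: field_simps)
qed

section \<open>Members of the class of the form z ^ m * Phi\<close>

lemma disk_fps_shifted:
  assumes "fps_X ^ m * \<Phi> \<in> fps_class k"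
  shows "disk_fps \<Phi>"
proof -
  have "\<Phi> = fps_shift m (fps_X ^ m * \<Phi>)" by (simp add: fps_eq_iff fps_X_power_mult_nth)
  then show ?thesis using fps_classD(1)[OF assms] by (metis fps_conv_radius_shift)
qed

lemma zcount_monom_times:
  assumes "disk_fps \<Phi>" "\<exists>z\<in>ball 0 1. eval_fps \<Phi> z \<noteq> 0" "0 < s" "s < 1"
  shows "zcount (\<lambda>z. z ^ m * eval_fps \<Phi> z) (ball 0 s) = m + zcount (eval_fps \<Phi>) (ball 0 s)"
proof -
  from zcount_poly_times[OF holomorphic_eval_disk_fps[OF assms(1)] assms(2,4), of "monom 1 m"]
  show ?thesis using assms(3) by (auto simp: poly_monom degree_monom_eq split: if_splits)
qed

lemma fps_class_few_zeros_shifted: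
  assumes H: "fps_X ^ m * \<Phi> \<in> fps_class k"
  shows "few_zeros k (\<lambda>z. z ^ m * eval_fps \<Phi> z + w)"
proof -
  have "few_zeros (k + 0) (\<lambda>z. z ^ 0 * eval_fps (fps_X ^ m * \<Phi>) z + poly [:w:] z)"
    by (rule fps_classD(2)[OF H]) simp
  then have "few_zeros (k + 0) (\<lambda>z. z ^ m * eval_fps \<Phi> z + w)"
    by (rule iffD1[OF few_zeros_cong, rotated])
      (use disk_fps_shifted[OF H] in \<open>simp add: eval_disk_fps\<close>)
  then show ?thesis by simp
qed

text \<open>The factor \<open>z ^ m\<close> already uses up all \<open>m\<close> admissible
  zeros.\<close>

lemma fps_class_zero_free:
  assumes H: "fps_X ^ m * \<Phi> \<in> fps_class m" and a: "norm a < 1"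
  shows "eval_fps \<Phi> a \<noteq> 0"
proof
  assume a0: "eval_fps \<Phi> a = 0"
  note D = disk_fps_shifted[OF H]
  have eq: "eval_fps (fps_X ^ m * \<Phi>) z = z ^ m * eval_fps \<Phi> z" if "norm z < 1" for z
    using that D by (simp add: eval_disk_fps)
  have nz: "\<exists>z\<in>ball 0 1. eval_fps \<Phi> z \<noteq> 0"
    using fps_class_nonconst[OF H, of 0] eq by force
  obtain t where t: "norm a < t" "t < 1" using a dense by blast
  have t0: "0 < t" using t(1) norm_ge_zero[of a] by linarith
  have "few_zeros m (\<lambda>z. z ^ m * eval_fps \<Phi> z)"
    using fps_class_few_zeros_shifted[OF H, of 0] by simp
  then have "zcount (\<lambda>z. z ^ m * eval_fps \<Phi> z) (ball 0 t) \<le> m"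
    using t(2) by (auto simp: few_zeros_def)
  moreover have "zcount (eval_fps \<Phi>) (ball 0 t) > 0"
    using zcount_less[OF holomorphic_eval_disk_fps[OF D] nz order_refl t a0] by simp
  ultimately show False using zcount_monom_times[OF D nz t0 t(2)] by simp
qed

text \<open>By Rouche's theorem a value smaller than the minimum on the circle of radius \<open>r\<close> is
  already taken \<open>m\<close> times inside that circle, so it is not taken again outside.\<close>

lemma fps_class_minimum:
  assumes H: "fps_X ^ m * \<Phi> \<in> fps_class m" and z0: "0 < r" "r \<le> norm z0" "norm z0 < 1"
  shows "\<exists>\<zeta>. norm \<zeta> = r \<and> r ^ m * norm (eval_fps \<Phi> \<zeta>) \<le> norm z0 ^ m * norm (eval_fps \<Phi> z0)"
proof (rule ccontr)
  assume neg: "\<not> ?thesis"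
  note D = disk_fps_shifted[OF H]
  define f where "f = (\<lambda>z. z ^ m * eval_fps \<Phi> z)"
  define w where "w = f z0"
  have eq: "eval_fps (fps_X ^ m * \<Phi>) z = f z" if "norm z < 1" for z
    using that D by (simp add: eval_disk_fps f_def)
  have r1: "r < 1" using z0 by simp
  have hf: "f holomorphic_on ball 0 1"
    unfolding f_def by (intro holomorphic_intros holomorphic_eval_disk_fps D)
  have less: "norm (- w) < norm (f z)" if "norm z = r" for z
    using neg that by (auto simp: w_def f_def norm_mult norm_power not_le)
  have nz\<Phi>: "\<exists>z\<in>ball 0 1. eval_fps \<Phi> z \<noteq> 0"
    using fps_class_zero_free[OF H, of 0] by (intro bexI[of _ 0]) auto
  have "zcount (\<lambda>z. f z + - w) (ball 0 r) = zcount f (ball 0 r)"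
    by (rule Rouche_circle[OF hf _ z0(1) r1 less]) auto
  also have "\<dots> \<ge> m"
    using zcount_monom_times[OF D nz\<Phi> z0(1) r1, of m] by (simp add: f_def)
  finally have 1: "m \<le> zcount (\<lambda>z. f z + - w) (ball 0 r)" .
  have few: "few_zeros m (\<lambda>z. f z + - w)"
    unfolding f_def by (rule fps_class_few_zeros_shifted[OF H])
  obtain t where t: "norm z0 < t" "t < 1" using z0(3) dense by blast
  have "zcount (\<lambda>z. f z + - w) (ball 0 r) < zcount (\<lambda>z. f z + - w) (ball 0 t)"
    by (rule zcount_less[OF _ _ z0(2) t]) (use hf few in \<open>auto simp: w_def few_zeros_def intro!: holomorphic_intros\<close>)
  moreover have "zcount (\<lambda>z. f z + - w) (ball 0 t) \<le> m" using few t(2) by (auto simp: few_zeros_def)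
  ultimately show False using 1 by linarith
qed

text \<open>The exponent is the solution \<open>M\<close> of
  \<open>M = m * ln 5 + (M + 1) / 2\<close>.\<close>

definition recip_bound :: "nat \<Rightarrow> real" where
  "recip_bound m = exp (1 + 2 * real m * ln 5)"

text \<open>With \<open>L = log (\<Phi> 0 / \<Phi>)\<close> and \<open>M s\<close> the maximum of \<open>Re L\<close> on the circle of radius \<open>s\<close>,
  the preceding lemma gives \<open>M s \<le> M (s / 5) + m * ln 5\<close>, while Borel-Caratheodory gives
  \<open>M (s / 5) \<le> (M s + 1) / 2\<close>.\<close>

lemma fps_class_recip_bound:
  assumes H: "fps_X ^ m * \<Phi> \<in> fps_class m" and z: "norm z < 1"
  shows "norm (fps_nth \<Phi> 0 / eval_fps \<Phi> z) \<le> recip_bound m"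
proof -
  note D = disk_fps_shifted[OF H]
  note zf = fps_class_zero_free[OF H]
  define c where "c = fps_nth \<Phi> 0"
  have c: "c \<noteq> 0" using zf[of 0] by (simp add: c_def eval_fps_at_0)
  have "(\<lambda>z. c / eval_fps \<Phi> z) holomorphic_on ball 0 1"
    using zf by (intro holomorphic_intros holomorphic_eval_disk_fps D) auto
  then obtain g where g: "g holomorphic_on ball 0 1" "\<And>z. norm z < 1 \<Longrightarrow> c / eval_fps \<Phi> z = exp (g z)"
    by (rule contractible_imp_holomorphic_log)
      (use zf c in \<open>auto simp: convex_imp_contractible\<close>)
  have g0: "exp (g 0) = 1" using g(2)[of 0] c by (simp add: eval_fps_at_0 c_def)
  \<comment> \<open>Since \<open>exp (g 0) = 1\<close>, subtracting \<open>g 0\<close> preserves the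
    exponential and gives \<open>L 0 = 0\<close>, as Borel-Caratheodory requires.\<close>
  define L where "L = (\<lambda>z. g z - g 0)"
  have L: "L holomorphic_on ball 0 1" "L 0 = 0" "\<And>z. norm z < 1 \<Longrightarrow> c / eval_fps \<Phi> z = exp (L z)"
    using g g0 by (auto simp: L_def exp_diff intro!: holomorphic_intros)
  have nL: "norm (eval_fps \<Phi> z) = norm c * exp (- Re (L z))" if "norm z < 1" for z
  proof -
    have "eval_fps \<Phi> z = c * exp (- L z)" using L(3)[OF that] zf[OF that] c
      by (simp add: exp_minus field_simps)
    then show ?thesis by (simp add: norm_mult)
  qed
  have "\<exists>s. norm z < s \<and> 0 < s \<and> s < 1" using dense[OF z] norm_ge_zero[of z] by (metis order_le_less_trans)
  then obtain s where s: "norm z < s" "0 < s" "s < 1" by blast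
  have sub: "cball 0 s \<subseteq> ball (0::complex) 1" using s by auto
  have contL: "continuous_on (cball 0 s) L"
    by (rule continuous_on_subset[OF holomorphic_on_imp_continuous_on[OF L(1)] sub])
  have "continuous_on (sphere 0 s) (\<lambda>z. Re (L z))"
    by (intro continuous_intros continuous_on_subset[OF contL]) auto
  from continuous_attains_sup[OF compact_sphere _ this]
  obtain z0 where z0: "norm z0 = s" "\<And>z. norm z = s \<Longrightarrow> Re (L z) \<le> Re (L z0)"
    using s by (auto simp: sphere_eq_empty)
  define M where "M = Re (L z0)"
  have Re_le: "Re (L w) \<le> M" if "norm w \<le> s" for w
  proof (rule maximum_real_frontier[of L "cball 0 s"])
    show "L holomorphic_on interior (cball 0 s)"
      by (rule holomorphic_on_subset[OF L(1)]) (use s in auto)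
    show "Re (L w) \<le> M" if "w \<in> frontier (cball 0 s)" for w
      using that s z0(2) by (auto simp: M_def frontier_cball)
  qed (use contL that in auto)
  obtain \<zeta> where \<zeta>: "norm \<zeta> = s / 5" "(s / 5) ^ m * norm (eval_fps \<Phi> \<zeta>) \<le> norm z0 ^ m * norm (eval_fps \<Phi> z0)"
    using fps_class_minimum[OF H, of "s / 5" z0] s z0(1) by auto
  \<comment> \<open>Adding 1 to \<open>M\<close> makes the bound on the real part strict. On the
    circle of radius \<open>s / 5\<close> the factor \<open>2 * norm z / (s - norm z)\<close> is
    1/2; being less than 1, it lets \<open>M\<close> be solved for.\<close>
  have "norm (L \<zeta>) \<le> 2 * (M + 1) * norm \<zeta> / (s - norm \<zeta>)"
  proof (rule Borel_Caratheodory)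
    show "L holomorphic_on ball 0 s" by (rule holomorphic_on_subset[OF L(1)]) (use s in auto)
    show "Re (L w) < M + 1" if "norm w < s" for w using Re_le[of w] that by simp
  qed (use L(2) \<zeta>(1) s in auto)
  also have "\<dots> = (M + 1) / 2" using \<zeta>(1) s by (simp add: field_simps)
  finally have R\<zeta>: "Re (L \<zeta>) \<le> (M + 1) / 2" using complex_Re_le_cmod[of "L \<zeta>"] by linarith
  have "(s / 5) ^ m * exp (- Re (L \<zeta>)) \<le> s ^ m * exp (- M)"
  proof -
    have "norm c * ((s / 5) ^ m * exp (- Re (L \<zeta>))) \<le> norm c * (s ^ m * exp (- M))"
      using \<zeta>(2) nL[of \<zeta>] nL[of z0] \<zeta>(1) z0(1) s by (simp add: M_def mult_ac)
    then show ?thesis using c by simp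
  qed
  then have "exp M \<le> 5 ^ m * exp (Re (L \<zeta>))"
    using s by (simp add: power_divide exp_minus field_simps)
  also have "\<dots> = exp (real m * ln 5 + Re (L \<zeta>))"
    by (simp add: exp_add exp_of_nat_mult)
  finally have "M \<le> real m * ln 5 + Re (L \<zeta>)" by simp
  with R\<zeta> have "M \<le> 1 + 2 * real m * ln 5" by (simp add: field_simps)
  then have "Re (L z) \<le> 1 + 2 * real m * ln 5" using Re_le[of z] s by simp
  then show ?thesis using L(3)[OF z] by (simp add: c_def recip_bound_def)
qed

definition normalized_recip :: "complex fps \<Rightarrow> complex fps" where
  "normalized_recip \<Phi> = fps_const (fps_nth \<Phi> 0) * inverse \<Phi>"

lemma fps_class_normalized_recip:
  assumes H: "fps_X ^ m * \<Phi> \<in> fps_class m"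
  shows "fps_nth \<Phi> 0 \<noteq> 0" "\<Phi> * normalized_recip \<Phi> = fps_const (fps_nth \<Phi> 0)"
    "fps_nth (normalized_recip \<Phi>) 0 = 1" "disk_fps (normalized_recip \<Phi>)"
    "norm (fps_nth (normalized_recip \<Phi>) k) \<le> recip_bound m * 2 ^ k"
proof -
  note D = disk_fps_shifted[OF H]
  note zf = fps_class_zero_free[OF H]
  show c: "fps_nth \<Phi> 0 \<noteq> 0" using zf[of 0] by (simp add: eval_fps_at_0)
  show eq: "\<Phi> * normalized_recip \<Phi> = fps_const (fps_nth \<Phi> 0)"
    using inverse_mult_eq_1[OF c] by (simp add: normalized_recip_def mult_ac)
  show "fps_nth (normalized_recip \<Phi>) 0 = 1" using c by (simp add: normalized_recip_def)
  have "disk_fps (inverse \<Phi>)"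
    using fps_conv_radius_inverse[of 1 \<Phi>] zf D by (auto simp: one_ereal_def min_def split: if_splits)
  then show D': "disk_fps (normalized_recip \<Phi>)"
    unfolding normalized_recip_def by (intro disk_fps_mult) auto
  \<comment> \<open>Cauchy's estimate on the circle of radius 1/2 produces the factor
    \<open>2 ^ k\<close>, uniformly over the class.\<close>
  have "norm (fps_nth (normalized_recip \<Phi>) k) \<le> recip_bound m / (1/2) ^ k"
  proof (rule fps_coeff_bound[OF D'])
    fix z :: complex assume "norm z = 1/2"
    then have z: "norm z < 1" by simp
    have "eval_fps \<Phi> z * eval_fps (normalized_recip \<Phi>) z = fps_nth \<Phi> 0"
      using arg_cong[OF eq, of "\<lambda>H. eval_fps H z"] z D D' by (simp add: eval_disk_fps)
    then have "eval_fps (normalized_recip \<Phi>) z = fps_nth \<Phi> 0 / eval_fps \<Phi> z"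
      using zf[OF z] by (simp add: field_simps)
    then show "norm (eval_fps (normalized_recip \<Phi>) z) \<le> recip_bound m"
      using fps_class_recip_bound[OF H z] by simp
  qed auto
  then show "norm (fps_nth (normalized_recip \<Phi>) k) \<le> recip_bound m * 2 ^ k"
    by (simp add: power_divide)
qed

subsection \<open>Holomorphic curves in the class\<close>

text \<open>Chosen so that \<open>mu\<close> times the truncation of psi below index
  \<open>l\<close> has modulus at most \<open>norm z ^ l / 4\<close> for \<open>norm z\<close> at
  least 1/2; this radius depends on \<open>m\<close> and \<open>l\<close> only, not on the member of
  the class.\<close>

definition flow_radius :: "nat \<Rightarrow> nat \<Rightarrow> real" where
  "flow_radius m l = 1 / (4 * (real l * recip_bound m * 2 ^ l))"

text \<open>Multiplied by \<open>z ^ m\<close>, this is, up to a constant, the perturbation of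
  \<open>fps_class_closed\<close> with \<open>Y\<close> equal to \<open>mu\<close> times the
  truncation of psi below index \<open>l\<close>.\<close>

definition flow :: "nat \<Rightarrow> complex \<Rightarrow> complex fps \<Rightarrow> complex fps" where
  "flow l \<mu> \<Phi> = \<Phi> * (1 - fps_const \<mu> * fps_shift l (normalized_recip \<Phi>))"

lemma recip_bound_pos: "0 < recip_bound m"
  by (simp add: recip_bound_def)

lemma flow_radius_pos: "1 \<le> l \<Longrightarrow> 0 < flow_radius m l"
  using recip_bound_pos[of m] by (simp add: flow_radius_def)

lemma flow_radius_coeff:
  assumes H: "fps_X ^ m * \<Phi> \<in> fps_class m" and l: "1 \<le> l" and \<mu>: "norm \<mu> \<le> flow_radius m l"
  shows "norm (\<mu> * fps_nth (normalized_recip \<Phi>) l) \<le> 1 / 4"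
proof -
  have "norm (\<mu> * fps_nth (normalized_recip \<Phi>) l) \<le> flow_radius m l * (recip_bound m * 2 ^ l)"
    unfolding norm_mult using fps_class_normalized_recip(5)[OF H, of l] \<mu> flow_radius_pos[OF l, of m]
    by (intro mult_mono) auto
  also have "\<dots> = 1 / (4 * real l)" using recip_bound_pos[of m] l by (simp add: flow_radius_def)
  also have "\<dots> \<le> 1 / 4" using l by (simp add: field_simps)
  finally show ?thesis .
qed

text \<open>Since Phi * psi is constant, multiplying \<open>z ^ m * Phi\<close> by the truncation of
  psi gives a multiple of \<open>z ^ m\<close> minus \<open>z ^ l\<close> times the wanted product.
  Shifting by \<open>l\<close>, at least \<open>m\<close>, leaves the change made by the flow and a
  constant.\<close>

lemma flow_in_class:
  assumes H: "fps_X ^ m * \<Phi> \<in> fps_class m" and l: "m \<le> l" "1 \<le> l" and \<mu>: "norm \<mu> \<le> flow_radius m l"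
  shows "fps_X ^ m * flow l \<mu> \<Phi> \<in> fps_class m"
proof -
  define \<psi> where "\<psi> = normalized_recip \<Phi>"
  note nr = fps_class_normalized_recip[OF H, folded \<psi>_def]
  note C = recip_bound_pos[of m]
  let ?S = "fps_shift l \<psi>"
  obtain y where y: "degree y \<le> l - 1" "fps_cutoff l \<psi> = fps_of_poly y"
    by (rule fps_eq_fps_of_polyI[of "l - 1" "fps_cutoff l \<psi>"]) auto
  define Y where "Y = smult \<mu> y"
  have "degree Y \<le> l - 1" unfolding Y_def using y(1) degree_smult_le[of \<mu> y] by linarith
  then have dY: "degree Y < l" using l by linarith
  have y_bound: "norm (poly y z) \<le> real l * recip_bound m * 2 ^ l * norm z ^ l" if z: "1 / 2 \<le> norm z" for z
  proof -
    have "coeff y i = (if i < l then fps_nth \<psi> i else 0)" for i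
      using arg_cong[OF y(2), of "\<lambda>H. fps_nth H i"] by simp
    then have "poly y z = (\<Sum>i<l. fps_nth \<psi> i * z ^ i)"
      unfolding poly_altdef using y(1) l
      by (intro sum.mono_neutral_cong_left) (auto intro: le_degree)
    then have "norm (poly y z) \<le> (\<Sum>i<l. norm (fps_nth \<psi> i) * norm z ^ i)"
      by (simp add: sum_norm_le norm_mult norm_power)
    \<comment> \<open>As \<open>2 * norm z\<close> is at least 1, its powers of exponent
      \<open>i < l\<close> are dominated by the \<open>l\<close>-th.\<close>
    also have "\<dots> \<le> (\<Sum>i<l. recip_bound m * (2 * norm z) ^ l)"
    proof (intro sum_mono)
      fix i assume i: "i \<in> {..<l}"
      have "norm (fps_nth \<psi> i) * norm z ^ i \<le> recip_bound m * 2 ^ i * norm z ^ i"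
        using nr(5)[of i] by (intro mult_right_mono) auto
      also have "\<dots> = recip_bound m * (2 * norm z) ^ i" by (simp add: power_mult_distrib)
      also have "\<dots> \<le> recip_bound m * (2 * norm z) ^ l"
        using i z C by (intro mult_left_mono power_increasing) auto
      finally show "norm (fps_nth \<psi> i) * norm z ^ i \<le> recip_bound m * (2 * norm z) ^ l" .
    qed
    also have "\<dots> = real l * recip_bound m * 2 ^ l * norm z ^ l" by (simp add: power_mult_distrib)
    finally show ?thesis .
  qed
  have "norm (poly Y z) \<le> 1 / 4 * norm z ^ l" if z: "1 / 2 \<le> norm z" for z
  proof -
    have "norm (poly Y z) \<le> flow_radius m l * (real l * recip_bound m * 2 ^ l * norm z ^ l)"
      unfolding Y_def poly_smult norm_mult using y_bound[OF z] \<mu> flow_radius_pos[OF l(2), of m]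
      by (intro mult_mono) auto
    also have "\<dots> = 1 / 4 * norm z ^ l" using C l by (simp add: flow_radius_def)
    finally show ?thesis .
  qed
  then have mem: "fps_X ^ m * \<Phi> + fps_shift l (fps_of_poly Y * (fps_X ^ m * \<Phi>)) \<in> fps_class m"
    by (intro fps_class_closed[OF H dY, of "1/4" "1/2"]) auto
  define c where "c = fps_nth \<Phi> 0"
  have "fps_cutoff l \<psi> = \<psi> - fps_X ^ l * ?S"
    using fps_shift_cutoff'[of l \<psi>] by (metis add_diff_cancel_left')
  then have Y_eq: "fps_of_poly Y = fps_const \<mu> * (\<psi> - fps_X ^ l * ?S)"
    unfolding Y_def fps_of_poly_smult using y(2) by simp
  have "fps_of_poly Y * (fps_X ^ m * \<Phi>) = fps_const \<mu> * fps_X ^ m * (\<Phi> * \<psi>) - fps_X ^ l * (fps_const \<mu> * fps_X ^ m * \<Phi> * ?S)"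
    unfolding Y_eq by (simp add: algebra_simps)
  also have "\<dots> = fps_const (\<mu> * c) * fps_X ^ m - fps_X ^ l * (fps_const \<mu> * fps_X ^ m * \<Phi> * ?S)"
    unfolding nr(2) c_def[symmetric] by (simp add: mult_ac flip: fps_const_mult)
  finally have eq: "fps_of_poly Y * (fps_X ^ m * \<Phi>)
      = fps_const (\<mu> * c) * fps_X ^ m - fps_X ^ l * (fps_const \<mu> * fps_X ^ m * \<Phi> * ?S)" .
  \<comment> \<open>The monomial of degree \<open>m\<close> survives the shift only for
    \<open>l = m\<close>, and then as a constant.\<close>
  define e where "e = (if l = m then \<mu> * c else 0)"
  have "fps_shift l (fps_of_poly Y * (fps_X ^ m * \<Phi>)) = fps_const e - fps_const \<mu> * fps_X ^ m * \<Phi> * ?S"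
    unfolding eq using l(1)
    by (auto simp: fps_eq_iff fps_X_power_nth fps_X_power_mult_nth e_def mult.assoc)
  then have "fps_X ^ m * flow l \<mu> \<Phi> = fps_X ^ m * \<Phi> + fps_shift l (fps_of_poly Y * (fps_X ^ m * \<Phi>)) + fps_const (- e)"
    by (simp add: flow_def \<psi>_def algebra_simps)
  then show ?thesis using fps_class_add_const[OF mem, of "- e"] by simp
qed

text \<open>The reciprocal gets divided by the factor that the flow multiplies with; the constant on
  the right is the constant coefficient of that factor and restores the normalization.\<close>

lemma normalized_recip_flow:
  assumes "fps_nth \<Phi> 0 \<noteq> 0"
  defines "\<psi> \<equiv> normalized_recip \<Phi>"
  assumes \<mu>: "\<mu> * fps_nth \<psi> l \<noteq> 1"
  shows "normalized_recip (flow l \<mu> \<Phi>) * (1 - fps_const \<mu> * fps_shift l \<psi>) = fps_const (1 - \<mu> * fps_nth \<psi> l) * \<psi>"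
proof -
  let ?D = "1 - fps_const \<mu> * fps_shift l \<psi>"
  have D0: "fps_nth ?D 0 = 1 - \<mu> * fps_nth \<psi> l" by simp
  then have D: "inverse ?D * ?D = 1" using \<mu> by (intro inverse_mult_eq_1) auto
  have "normalized_recip (flow l \<mu> \<Phi>) = fps_const (fps_nth \<Phi> 0 * (1 - \<mu> * fps_nth \<psi> l)) * (inverse \<Phi> * inverse ?D)"
    unfolding normalized_recip_def flow_def by (simp add: fps_inverse_mult \<psi>_def normalized_recip_def)
  also have "\<dots> = fps_const (1 - \<mu> * fps_nth \<psi> l) * \<psi> * inverse ?D"
    by (simp add: \<psi>_def normalized_recip_def mult_ac flip: fps_const_mult)
  finally show ?thesis using D by (simp add: mult.assoc)
qed

text \<open>In the coefficients of \<open>normalized_recip_flow\<close> the unknown of index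
  \<open>k\<close> also occurs in the convolution, with factor \<open>fps_nth psi l\<close>; solving
  for it gives a recursion that is rational in \<open>mu\<close>.\<close>

lemma flow_coeff_rec:
  assumes "fps_nth \<Phi> 0 \<noteq> 0"
  defines "\<psi> \<equiv> normalized_recip \<Phi>"
  assumes \<mu>: "\<mu> * fps_nth \<psi> l \<noteq> 1"
  shows "fps_nth (normalized_recip (flow l \<mu> \<Phi>)) k = fps_nth \<psi> k +
    \<mu> / (1 - \<mu> * fps_nth \<psi> l) * (\<Sum>i<k. fps_nth (normalized_recip (flow l \<mu> \<Phi>)) i * fps_nth \<psi> (k - i + l))"
proof -
  let ?P = "normalized_recip (flow l \<mu> \<Phi>)"
  have "?P - fps_const \<mu> * (?P * fps_shift l \<psi>) = fps_const (1 - \<mu> * fps_nth \<psi> l) * \<psi>"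
    using normalized_recip_flow[of \<Phi> \<mu> l] assms(1) \<mu> unfolding \<psi>_def by (simp add: algebra_simps)
  from arg_cong[OF this, of "\<lambda>F. fps_nth F k"]
  have "fps_nth ?P k - \<mu> * fps_nth (?P * fps_shift l \<psi>) k = (1 - \<mu> * fps_nth \<psi> l) * fps_nth \<psi> k"
    by (simp only: fps_sub_nth fps_mult_left_const_nth)
  moreover have "fps_nth (?P * fps_shift l \<psi>) k = (\<Sum>i=0..k. fps_nth ?P i * fps_nth \<psi> (k - i + l))"
    by (simp only: fps_mult_nth fps_shift_nth)
  ultimately have "fps_nth ?P k - \<mu> * (\<Sum>i=0..k. fps_nth ?P i * fps_nth \<psi> (k - i + l)) = (1 - \<mu> * fps_nth \<psi> l) * fps_nth \<psi> k"
    by (simp only:)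
  moreover have "(\<Sum>i=0..k. fps_nth ?P i * fps_nth \<psi> (k - i + l))
      = (\<Sum>i<k. fps_nth ?P i * fps_nth \<psi> (k - i + l)) + fps_nth ?P k * fps_nth \<psi> l"
    by (simp add: atLeast0AtMost flip: lessThan_Suc_atMost)
  ultimately have "(1 - \<mu> * fps_nth \<psi> l) * fps_nth ?P k = (1 - \<mu> * fps_nth \<psi> l) * fps_nth \<psi> k
      + \<mu> * (\<Sum>i<k. fps_nth ?P i * fps_nth \<psi> (k - i + l))"
    by (simp add: algebra_simps)
  moreover have "1 - \<mu> * fps_nth \<psi> l \<noteq> 0" using \<mu> by simp
  ultimately show ?thesis by (simp add: field_simps)
qed

lemma holomorphic_flow_coeff:
  assumes "fps_nth \<Phi> 0 \<noteq> 0" and U: "\<And>\<mu>. \<mu> \<in> U \<Longrightarrow> \<mu> * fps_nth (normalized_recip \<Phi>) l \<noteq> 1"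
  shows "(\<lambda>\<mu>. fps_nth (normalized_recip (flow l \<mu> \<Phi>)) k) holomorphic_on U"
proof (induction k rule: less_induct)
  case (less k)
  let ?\<psi> = "normalized_recip \<Phi>"
  have "1 - \<mu> * fps_nth ?\<psi> l \<noteq> 0" if "\<mu> \<in> U" for \<mu> using U[OF that] by simp
  then have "(\<lambda>\<mu>. fps_nth ?\<psi> k + \<mu> / (1 - \<mu> * fps_nth ?\<psi> l) *
      (\<Sum>i<k. fps_nth (normalized_recip (flow l \<mu> \<Phi>)) i * fps_nth ?\<psi> (k - i + l))) holomorphic_on U"
    using less by (intro holomorphic_intros) auto
  then show ?case
    by (rule holomorphic_transform) (use flow_coeff_rec[OF assms(1)] U in auto)
qed

text \<open>By the maximum principle the real part attains on the circle at least its value at the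
  centre, which is 0.\<close>

lemma Re_nonneg_on_sphere:
  assumes \<Theta>: "\<Theta> holomorphic_on cball 0 r" "\<Theta> 0 = 0" and r: "0 < r"
  shows "\<exists>\<mu>. norm \<mu> = r \<and> 0 \<le> Re (\<Theta> \<mu>)"
proof -
  have cont: "continuous_on (cball 0 r) \<Theta>" by (rule holomorphic_on_imp_continuous_on[OF \<Theta>(1)])
  have "continuous_on (sphere 0 r) (\<lambda>z. Re (\<Theta> z))"
    by (intro continuous_intros continuous_on_subset[OF cont]) auto
  from continuous_attains_sup[OF compact_sphere _ this]
  obtain \<mu> where \<mu>: "norm \<mu> = r" "\<And>z. norm z = r \<Longrightarrow> Re (\<Theta> z) \<le> Re (\<Theta> \<mu>)"
    using r by (auto simp: sphere_eq_empty)
  have "Re (\<Theta> 0) \<le> Re (\<Theta> \<mu>)"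
    by (rule maximum_real_frontier[of \<Theta> "cball 0 r"])
      (use holomorphic_on_subset[OF \<Theta>(1), of "ball 0 r"] cont \<mu> r in \<open>auto simp: frontier_cball\<close>)
  then show ?thesis using \<mu>(1) \<Theta>(2) by auto
qed

text \<open>For \<open>b\<close> moving holomorphically from \<open>a\<close>, the middle term is
  the real part of a holomorphic function vanishing at the start. Where it is nonnegative, the last
  square is pure gain.\<close>

lemma norm_sq_ge_Re: "(norm a)\<^sup>2 + 2 * Re ((b - a) * cnj a) + (norm (b - a))\<^sup>2 = (norm b)\<^sup>2"
  unfolding cmod_power2 by (simp add: power2_eq_square algebra_simps)

text \<open>\<open>\<mu> \<mapsto> flow l \<mu> \<Phi>\<close> is a holomorphic curve along which the coefficient of index 1 has
  derivative \<open>\<psi>\<close> at \<open>l + 1\<close>; subharmonicity of the squared norms gives the gain.\<close>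

lemma flow_gain:
  assumes H: "fps_X ^ m * \<Phi> \<in> fps_class m" and l: "1 \<le> l" and \<epsilon>: "0 \<le> \<epsilon>"
  defines "\<psi> \<equiv> normalized_recip \<Phi>"
  obtains \<mu> where "norm \<mu> = flow_radius m l"
    "(norm (fps_nth \<psi> (Suc l)))\<^sup>2 + \<epsilon> * (norm (fps_nth \<psi> 1))\<^sup>2
        + \<epsilon> * (flow_radius m l)\<^sup>2 * (norm (fps_nth \<psi> (Suc l)))\<^sup>2 / 2
      \<le> (norm (fps_nth (normalized_recip (flow l \<mu> \<Phi>)) (Suc l)))\<^sup>2
        + \<epsilon> * (norm (fps_nth (normalized_recip (flow l \<mu> \<Phi>)) 1))\<^sup>2"
proof -
  define r where "r = flow_radius m l"
  have r: "0 < r" unfolding r_def by (rule flow_radius_pos[OF l])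
  note nr = fps_class_normalized_recip[OF H, folded \<psi>_def]
  define P where "P = (\<lambda>k \<mu>. fps_nth (normalized_recip (flow l \<mu> \<Phi>)) k)"
  have small: "norm (\<mu> * fps_nth \<psi> l) \<le> 1 / 4" if "norm \<mu> \<le> r" for \<mu>
    using flow_radius_coeff[OF H l, of \<mu>] that by (simp add: r_def \<psi>_def)
  have ne: "\<mu> * fps_nth \<psi> l \<noteq> 1" if "norm \<mu> \<le> r" for \<mu>
  proof
    assume "\<mu> * fps_nth \<psi> l = 1"
    then show False using small[OF that] by simp
  qed
  have hol: "P k holomorphic_on cball 0 r" for k
    unfolding P_def by (rule holomorphic_flow_coeff[OF nr(1)]) (use ne in \<open>auto simp: \<psi>_def\<close>)
  have P0: "P k 0 = fps_nth \<psi> k" for k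
    by (simp add: P_def flow_def \<psi>_def)
  \<comment> \<open>For \<open>k = 0\<close> the sum in the recursion is empty, so the new
    coefficient of index 0 is again 1; this is the only one entering for
    \<open>k = 1\<close>.\<close>
  have P1: "P 1 \<mu> - fps_nth \<psi> 1 = \<mu> * fps_nth \<psi> (Suc l) / (1 - \<mu> * fps_nth \<psi> l)" if "norm \<mu> \<le> r" for \<mu>
    using flow_coeff_rec[OF nr(1), of \<mu> l 1] flow_coeff_rec[OF nr(1), of \<mu> l 0] ne[OF that] nr(3)
    by (simp add: P_def \<psi>_def)
  \<comment> \<open>The linear terms of both squared norms are combined, so that a single
    \<open>mu\<close> serves both.\<close>
  define \<Theta> where "\<Theta> = (\<lambda>\<mu>. 2 * ((P (Suc l) \<mu> - fps_nth \<psi> (Suc l)) * cnj (fps_nth \<psi> (Suc l))) +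
      of_real \<epsilon> * (2 * ((P 1 \<mu> - fps_nth \<psi> 1) * cnj (fps_nth \<psi> 1))))"
  have "\<Theta> holomorphic_on cball 0 r" unfolding \<Theta>_def by (intro holomorphic_intros hol)
  then obtain \<mu> where \<mu>: "norm \<mu> = r" "0 \<le> Re (\<Theta> \<mu>)"
    using Re_nonneg_on_sphere[of \<Theta> r] r by (auto simp: \<Theta>_def P0)
  \<comment> \<open>The denominator in \<open>P1\<close> is at most 5/4 in modulus, and its square
    25/16 is below 2.\<close>
  have gain: "r\<^sup>2 * (norm (fps_nth \<psi> (Suc l)))\<^sup>2 / 2 \<le> (norm (P 1 \<mu> - fps_nth \<psi> 1))\<^sup>2"
  proof -
    define D where "D = norm (1 - \<mu> * fps_nth \<psi> l)"
    have "D \<le> norm (1::complex) + norm (\<mu> * fps_nth \<psi> l)" unfolding D_def by (rule norm_triangle_ineq4)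
    then have D: "D \<le> 5 / 4" using small[of \<mu>] \<mu>(1) by simp
    have "D > 0" using ne[of \<mu>] \<mu>(1) by (auto simp: D_def)
    have "D\<^sup>2 \<le> (5/4)\<^sup>2" using D \<open>D > 0\<close> by (intro power_mono) auto
    then have "D\<^sup>2 \<le> 2" by (simp add: power2_eq_square)
    then have "(r * norm (fps_nth \<psi> (Suc l)))\<^sup>2 / 2 \<le> (r * norm (fps_nth \<psi> (Suc l)))\<^sup>2 / D\<^sup>2"
      using \<open>D > 0\<close> by (intro divide_left_mono) auto
    also have "\<dots> = (norm (P 1 \<mu> - fps_nth \<psi> 1))\<^sup>2"
      using P1[of \<mu>] \<mu>(1) by (simp add: norm_mult norm_divide D_def power_divide)
    finally show ?thesis by (simp add: power_mult_distrib)
  qed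
  have "(norm (fps_nth \<psi> (Suc l)))\<^sup>2 + 2 * Re ((P (Suc l) \<mu> - fps_nth \<psi> (Suc l)) * cnj (fps_nth \<psi> (Suc l))) \<le> (norm (P (Suc l) \<mu>))\<^sup>2"
    using norm_sq_ge_Re[of "fps_nth \<psi> (Suc l)" "P (Suc l) \<mu>"] zero_le_power2[of "norm (P (Suc l) \<mu> - fps_nth \<psi> (Suc l))"]
    by linarith
  moreover have "\<epsilon> * ((norm (fps_nth \<psi> 1))\<^sup>2 + 2 * Re ((P 1 \<mu> - fps_nth \<psi> 1) * cnj (fps_nth \<psi> 1))
      + r\<^sup>2 * (norm (fps_nth \<psi> (Suc l)))\<^sup>2 / 2) \<le> \<epsilon> * (norm (P 1 \<mu>))\<^sup>2"
    using norm_sq_ge_Re[of "fps_nth \<psi> 1" "P 1 \<mu>"] gain \<epsilon> by (intro mult_left_mono) linarith+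
  moreover have "Re (\<Theta> \<mu>) = 2 * Re ((P (Suc l) \<mu> - fps_nth \<psi> (Suc l)) * cnj (fps_nth \<psi> (Suc l)))
      + \<epsilon> * (2 * Re ((P 1 \<mu> - fps_nth \<psi> 1) * cnj (fps_nth \<psi> 1)))"
    by (simp add: \<Theta>_def)
  ultimately show ?thesis
    using \<mu> by (intro that[of \<mu>]) (simp_all add: r_def P_def algebra_simps)
qed

text \<open>The functional \<open>V\<close> is bounded on the class. If the coefficient were
  nonzero, a near-maximizer of \<open>V\<close> would still have a sizable coefficient at
  \<open>Suc l\<close>, and one step of the flow would raise \<open>V\<close> above its
  supremum.\<close>

lemma normalized_recip_coeff_zero:
  assumes H0: "fps_X ^ m * \<Phi>\<^sub>0 \<in> fps_class m" and l: "m \<le> l" "1 \<le> l"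
  shows "fps_nth (normalized_recip \<Phi>\<^sub>0) (Suc l) = 0"
proof (rule ccontr)
  define h where "h = (norm (fps_nth (normalized_recip \<Phi>\<^sub>0) (Suc l)))\<^sup>2"
  define A where "A = {\<Phi>. fps_X ^ m * \<Phi> \<in> fps_class m}"
  define K where "K = recip_bound m * 2"
  \<comment> \<open>\<open>K\<close> bounds the coefficient of index 1, so the second summand of
    \<open>V\<close> is at most \<open>h / 2\<close> on the class.\<close>
  define \<epsilon> where "\<epsilon> = h / (2 * K\<^sup>2)"
  define V where "V = (\<lambda>\<Phi>. (norm (fps_nth (normalized_recip \<Phi>) (Suc l)))\<^sup>2 + \<epsilon> * (norm (fps_nth (normalized_recip \<Phi>) 1))\<^sup>2)"
  define r where "r = flow_radius m l"
  assume "fps_nth (normalized_recip \<Phi>\<^sub>0) (Suc l) \<noteq> 0"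
  then have h: "h > 0" by (simp add: h_def)
  have K: "K > 0" using recip_bound_pos[of m] by (simp add: K_def)
  have \<epsilon>: "\<epsilon> > 0" using h K by (simp add: \<epsilon>_def)
  have r: "r > 0" unfolding r_def by (rule flow_radius_pos[OF l(2)])
  have \<epsilon>K: "\<epsilon> * (norm (fps_nth (normalized_recip \<Phi>) 1))\<^sup>2 \<le> h / 2" if "\<Phi> \<in> A" for \<Phi>
  proof -
    have "norm (fps_nth (normalized_recip \<Phi>) 1) \<le> K"
      using fps_class_normalized_recip(5)[of m \<Phi> 1] that by (simp add: A_def K_def)
    then have "\<epsilon> * (norm (fps_nth (normalized_recip \<Phi>) 1))\<^sup>2 \<le> \<epsilon> * K\<^sup>2"
      using \<epsilon> by (intro mult_left_mono power_mono) auto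
    also have "\<dots> = h / 2" using K by (simp add: \<epsilon>_def)
    finally show ?thesis .
  qed
  have bdd: "bdd_above (V ` A)"
  proof (rule bdd_aboveI2)
    fix \<Phi> assume "\<Phi> \<in> A"
    have "norm (fps_nth (normalized_recip \<Phi>) (Suc l)) \<le> recip_bound m * 2 ^ Suc l"
      using fps_class_normalized_recip(5)[of m \<Phi> "Suc l"] \<open>\<Phi> \<in> A\<close> by (simp add: A_def)
    then have "(norm (fps_nth (normalized_recip \<Phi>) (Suc l)))\<^sup>2 \<le> (recip_bound m * 2 ^ Suc l)\<^sup>2"
      by (intro power_mono) auto
    then show "V \<Phi> \<le> (recip_bound m * 2 ^ Suc l)\<^sup>2 + h / 2"
      unfolding V_def using \<epsilon>K[OF \<open>\<Phi> \<in> A\<close>] by linarith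
  qed
  have \<Phi>0: "\<Phi>\<^sub>0 \<in> A" using H0 by (simp add: A_def)
  \<comment> \<open>The first entry leaves at least \<open>h - h / 4 - h / 2 = h / 4\<close> for the
    squared coefficient of a near-maximizer; the second is the gain from \<open>flow_gain\<close>
    that this guarantees.\<close>
  define \<eta> where "\<eta> = min (h / 4) (\<epsilon> * r\<^sup>2 * h / 8)"
  have \<eta>: "\<eta> > 0" using h \<epsilon> r by (simp add: \<eta>_def)
  have "h \<le> V \<Phi>\<^sub>0" using \<epsilon> by (simp add: V_def h_def)
  then have sup_h: "h \<le> Sup (V ` A)" using cSUP_upper[OF \<Phi>0 bdd] by linarith
  have "Sup (V ` A) - \<eta> < Sup (V ` A)" using \<eta> by simp
  then obtain \<Phi> where \<Phi>: "\<Phi> \<in> A" "Sup (V ` A) - \<eta> < V \<Phi>"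
    using less_cSUP_iff[OF _ bdd, of "Sup (V ` A) - \<eta>"] \<Phi>0 by blast
  have H: "fps_X ^ m * \<Phi> \<in> fps_class m" using \<Phi>(1) by (simp add: A_def)
  have "h / 4 \<le> (norm (fps_nth (normalized_recip \<Phi>) (Suc l)))\<^sup>2"
    using \<Phi>(2) \<epsilon>K[OF \<Phi>(1)] sup_h unfolding V_def \<eta>_def by linarith
  then have "\<epsilon> * r\<^sup>2 / 2 * (h / 4) \<le> \<epsilon> * r\<^sup>2 / 2 * (norm (fps_nth (normalized_recip \<Phi>) (Suc l)))\<^sup>2"
    using \<epsilon> by (intro mult_left_mono) auto
  then have "\<epsilon> * r\<^sup>2 * h / 8 \<le> \<epsilon> * r\<^sup>2 * (norm (fps_nth (normalized_recip \<Phi>) (Suc l)))\<^sup>2 / 2"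
    by (simp add: field_simps)
  then have big: "\<eta> \<le> \<epsilon> * r\<^sup>2 * (norm (fps_nth (normalized_recip \<Phi>) (Suc l)))\<^sup>2 / 2"
    unfolding \<eta>_def by linarith
  obtain \<mu> where \<mu>: "norm \<mu> = r" "V \<Phi> + \<epsilon> * r\<^sup>2 * (norm (fps_nth (normalized_recip \<Phi>) (Suc l)))\<^sup>2 / 2 \<le> V (flow l \<mu> \<Phi>)"
    using flow_gain[OF H l(2) less_imp_le[OF \<epsilon>]] unfolding V_def r_def by blast
  have "flow l \<mu> \<Phi> \<in> A"
    using flow_in_class[OF H l, of \<mu>] \<mu>(1) by (simp add: A_def r_def)
  then have "V (flow l \<mu> \<Phi>) \<le> Sup (V ` A)" by (rule cSUP_upper[OF _ bdd])
  then show False using \<mu>(2) big \<Phi>(2) by linarith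
qed

subsection \<open>Rationality\<close>

text \<open>Subtracting the value at 0 creates a zero at 0.\<close>

lemma fps_class_0_empty: "F \<notin> fps_class 0"
proof
  assume F: "F \<in> fps_class 0"
  define f where "f = (\<lambda>z. eval_fps F z - fps_nth F 0)"
  have "few_zeros 0 f"
    using fps_class_few_zeros_shifted[of 0 F 0 "- fps_nth F 0"] F by (simp add: f_def)
  moreover have "f holomorphic_on ball 0 1"
    unfolding f_def by (intro holomorphic_intros holomorphic_eval_disk_fps fps_classD(1)[OF F])
  ultimately show False
    using zcount_less[of f 0 0 "1/2"] by (auto simp: few_zeros_def f_def eval_fps_at_0)
qed

text \<open>Multiplying \<open>z ^ j * (z ^ k * E) + p'\<close> by \<open>Q\<close> gives
  \<open>z ^ (j + k + n) * F\<close> plus a polynomial of degree at most \<open>j + k + n\<close>.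
  This has at most \<open>k + (j + k + n)\<close> zeros, of which \<open>k + n\<close> belong to
  \<open>Q\<close>.\<close>

lemma fps_class_cofactor:
  assumes F: "F \<in> fps_class k" and p: "degree p \<le> n"
    and Q: "degree Q = k + n" "Q \<noteq> 0" "\<And>z. poly Q z = 0 \<Longrightarrow> norm z < s" "s < 1"
    and E: "disk_fps E" and eq: "fps_X ^ n * F + fps_of_poly p = fps_of_poly Q * E"
  shows "fps_X ^ k * E \<in> fps_class k"
  unfolding fps_class_def
proof (intro CollectI conjI allI impI)
  note FD = fps_classD(1)[OF F]
  show "disk_fps (fps_X ^ k * E)" using E by (intro disk_fps_intros) auto
  fix j and p' :: "complex poly" assume p': "degree p' \<le> j"
  define G where "G = (\<lambda>z. z ^ j * eval_fps (fps_X ^ k * E) z + poly p' z)"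
  have G: "G holomorphic_on ball 0 1"
    unfolding G_def using E by (intro holomorphic_intros holomorphic_eval_disk_fps disk_fps_intros) auto
  define R where "R = monom 1 (j + k) * p + Q * p'"
  have "degree R \<le> j + k + n"
    unfolding R_def
  proof (rule degree_add_le)
    show "degree (monom 1 (j + k) * p) \<le> j + k + n"
      using degree_mult_le[of "monom 1 (j + k)" p] p by (simp add: degree_monom_eq)
    show "degree (Q * p') \<le> j + k + n"
      using degree_mult_le[of Q p'] Q(1) p' by simp
  qed
  then have "few_zeros (k + (j + k + n)) (\<lambda>z. z ^ (j + k + n) * eval_fps F z + poly R z)"
    by (rule fps_classD(2)[OF F])
  moreover have "z ^ (j + k + n) * eval_fps F z + poly R z = poly Q z * G z" if "norm z < 1" for z
  proof -
    have "z ^ n * eval_fps F z + poly p z = poly Q z * eval_fps E z"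
      using arg_cong[OF eq, of "\<lambda>H. eval_fps H z"] that FD E by (simp add: eval_disk_fps disk_fps_intros)
    then have "z ^ (j + k) * (z ^ n * eval_fps F z + poly p z) = z ^ (j + k) * (poly Q z * eval_fps E z)" by simp
    then show ?thesis using that E
      by (simp add: R_def G_def poly_monom power_add eval_disk_fps algebra_simps)
  qed
  ultimately have few: "few_zeros (k + (j + k + n)) (\<lambda>z. poly Q z * G z)"
    by (metis (no_types, lifting) few_zeros_cong)
  then have nz: "\<exists>z\<in>ball 0 1. G z \<noteq> 0" by (auto simp: few_zeros_def)
  have "zcount G (ball 0 t) \<le> k + j" if t: "t < 1" for t
  proof -
    \<comment> \<open>The radius is enlarged to enclose all roots of \<open>Q\<close>.\<close>
    let ?u = "max s t"
    have u: "?u < 1" using t Q(4) by simp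
    have "zcount (\<lambda>z. poly Q z * G z) (ball 0 ?u) = degree Q + zcount G (ball 0 ?u)"
      using Q(3) by (intro zcount_poly_times[OF G nz u Q(2)]) force
    moreover have "zcount (\<lambda>z. poly Q z * G z) (ball 0 ?u) \<le> k + (j + k + n)"
      using few u by (auto simp: few_zeros_def)
    ultimately have "zcount G (ball 0 ?u) \<le> k + j" using Q(1) by linarith
    moreover have "zcount G (ball 0 t) \<le> zcount G (ball 0 ?u)" by (rule zcount_mono[OF G nz _ u]) simp
    ultimately show ?thesis by linarith
  qed
  then show "few_zeros (k + j) (\<lambda>z. z ^ j * eval_fps (fps_X ^ k * E) z + poly p' z)"
    using nz by (simp add: few_zeros_def G_def)
qed

lemma fps_class_shifted_recip_poly:
  assumes H: "fps_X ^ k * E \<in> fps_class k" and k: "1 \<le> k"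
  obtains B where "degree B \<le> k" "B \<noteq> 0" "E * fps_of_poly B = fps_const (fps_nth E 0)"
proof -
  note nr = fps_class_normalized_recip[OF H]
  have "fps_nth (normalized_recip E) i = 0" if "k < i" for i
  proof -
    from that obtain l where l: "i = Suc l" by (cases i) auto
    then have "k \<le> l" using that by simp
    with l show ?thesis using normalized_recip_coeff_zero[OF H, of l] k by simp
  qed
  then obtain B where B: "degree B \<le> k" "normalized_recip E = fps_of_poly B"
    using fps_eq_fps_of_polyI[of k "normalized_recip E"] by blast
  moreover have "B \<noteq> 0" using nr(3) B(2) by auto
  ultimately show ?thesis using nr(2) by (intro that[of B]) auto
qed

text \<open>For the least \<open>k\<close> with \<open>F \<in> fps_class k\<close> some \<open>z ^ n * F + p\<close> has exactly \<open>n + k\<close> zeros;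
  the cofactor \<open>E\<close> of these zeros is the reciprocal of a polynomial.\<close>

lemma fps_class_rational:
  assumes "F \<in> fps_class m"
  obtains P B where "degree P \<le> m" "degree B \<le> m" "B \<noteq> 0" "fps_of_poly B * F = fps_of_poly P"
proof -
  define k where "k = (LEAST k. F \<in> fps_class k)"
  have F: "F \<in> fps_class k" unfolding k_def by (rule LeastI[of "\<lambda>k. F \<in> fps_class k", OF assms])
  have km: "k \<le> m" unfolding k_def by (rule Least_le[of "\<lambda>k. F \<in> fps_class k", OF assms])
  note FD = fps_classD(1)[OF F]
  have k1: "1 \<le> k" using F fps_class_0_empty by (cases k) auto
  \<comment> \<open>Minimality of \<open>k\<close> gives a witness that exceeds the bound for
    \<open>k - 1\<close>; it is not the zero function because \<open>F\<close> lies in the class for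
    \<open>k\<close>.\<close>
  have "F \<notin> fps_class (k - 1)"
    using not_less_Least[of "k - 1" "\<lambda>k. F \<in> fps_class k"] k1 unfolding k_def by linarith
  then obtain n p where p: "degree p \<le> n" and
    few: "\<not> few_zeros (k - 1 + n) (\<lambda>z. z ^ n * eval_fps F z + poly p z)"
    using FD unfolding fps_class_def by blast
  define f where "f = (\<lambda>z. z ^ n * eval_fps F z + poly p z)"
  have f: "f holomorphic_on ball 0 1"
    unfolding f_def by (intro holomorphic_intros holomorphic_eval_disk_fps FD)
  have nz: "\<exists>z\<in>ball 0 1. f z \<noteq> 0"
    using fps_classD(2)[OF F p] by (simp add: few_zeros_def f_def)
  then obtain s where s: "s < 1" "\<not> zcount f (ball 0 s) \<le> k - 1 + n"
    using few unfolding few_zeros_def f_def by blast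
  then have "k + n \<le> zcount f (ball 0 s)" using k1 by linarith
  then obtain Q h where Q: "degree Q = k + n" "Q \<noteq> 0" "\<And>z. poly Q z = 0 \<Longrightarrow> norm z < s"
    and h: "h holomorphic_on ball 0 1" "\<And>z. norm z < 1 \<Longrightarrow> f z = poly Q z * h z"
    using zcount_ge_imp_factor[OF f nz s(1)] by metis
  define E where "E = fps_expansion h 0"
  note E = fps_expansion_disk[OF h(1), folded E_def]
  have eq: "fps_X ^ n * F + fps_of_poly p = fps_of_poly Q * E"
  proof (rule disk_fps_eqI)
    fix z :: complex assume "norm z < 1"
    then show "eval_fps (fps_X ^ n * F + fps_of_poly p) z = eval_fps (fps_of_poly Q * E) z"
      using h(2)[of z] E FD by (simp add: eval_disk_fps disk_fps_intros f_def)
  qed (use FD E in \<open>auto intro!: disk_fps_intros\<close>)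
  obtain B where B: "degree B \<le> k" "B \<noteq> 0" "E * fps_of_poly B = fps_const (fps_nth E 0)"
    using fps_class_shifted_recip_poly[OF fps_class_cofactor[OF F p Q s(1) E(1) eq] k1] by blast
  \<comment> \<open>Since \<open>E * B\<close> is the constant \<open>E 0\<close>, multiplying
    \<open>z ^ n * F + p = Q * E\<close> by \<open>B\<close> yields
    \<open>z ^ n * B * F = T\<close>. Cancelling \<open>z ^ n\<close> leaves degree at most
    \<open>k\<close>.\<close>
  define T where "T = smult (fps_nth E 0) Q - B * p"
  have "fps_X ^ n * (fps_of_poly B * F) = fps_of_poly B * (fps_X ^ n * F + fps_of_poly p) - fps_of_poly (B * p)"
    by (simp add: algebra_simps fps_of_poly_mult)
  also have "\<dots> = fps_of_poly Q * (E * fps_of_poly B) - fps_of_poly (B * p)"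
    unfolding eq by (simp add: algebra_simps)
  also have "\<dots> = fps_of_poly T"
    unfolding B(3) T_def by (simp add: fps_of_poly_diff fps_of_poly_smult mult.commute)
  finally have T: "fps_X ^ n * (fps_of_poly B * F) = fps_of_poly T" .
  have "degree T \<le> k + n"
    unfolding T_def using degree_smult_le[of "fps_nth E 0" Q] Q(1) degree_mult_le[of B p] B(1) p
    by (intro degree_diff_le) auto
  then have "fps_nth (fps_of_poly B * F) i = 0" if "k < i" for i
  proof -
    have "fps_nth (fps_of_poly B * F) i = fps_nth (fps_X ^ n * (fps_of_poly B * F)) (i + n)"
      by (simp add: fps_X_power_mult_nth)
    also have "\<dots> = 0" unfolding T fps_of_poly_nth
      by (rule coeff_eq_0) (use \<open>degree T \<le> k + n\<close> that in linarith)
    finally show ?thesis .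
  qed
  then obtain P where "degree P \<le> k" "fps_of_poly B * F = fps_of_poly P"
    using fps_eq_fps_of_polyI[of k "fps_of_poly B * F"] by blast
  then show ?thesis using that[of P B] B km by simp
qed

text \<open>A root of \<open>B\<close> in the disk is also a root of \<open>P\<close>, because
  \<open>F\<close> converges there; dividing both by the linear factor lowers the degree of
  \<open>B\<close>. This supplies the pole-free denominator that
  \<open>holomorphic_rational_on\<close> demands.\<close>

lemma cancel_common_roots:
  assumes F: "disk_fps F" and "B \<noteq> 0" "fps_of_poly B * F = fps_of_poly P" "degree P \<le> m" "degree B \<le> m"
  shows "\<exists>P' B'. degree P' \<le> m \<and> degree B' \<le> m \<and> B' \<noteq> 0 \<and> fps_of_poly B' * F = fps_of_poly P' \<and>
    (\<forall>z\<in>ball 0 1. poly B' z \<noteq> 0)"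
  using assms(2-5)
proof (induction "degree B" arbitrary: B P rule: less_induct)
  case less
  show ?case
  proof (cases "\<forall>z\<in>ball 0 1. poly B z \<noteq> 0")
    case True
    then show ?thesis using less.prems by blast
  next
    case False
    then obtain a where a: "norm a < 1" "poly B a = 0" by auto
    have "poly P a = 0"
      using arg_cong[OF less.prems(2), of "\<lambda>H. eval_fps H a"] a F by (simp add: eval_disk_fps)
    then obtain P1 where P1: "P = [:-a, 1:] * P1" by (metis poly_eq_0_iff_dvd dvdE)
    obtain B1 where B1: "B = [:-a, 1:] * B1" using a(2) by (metis poly_eq_0_iff_dvd dvdE)
    have B1nz: "B1 \<noteq> 0" using B1 less.prems(1) by auto
    have dB: "degree B = Suc (degree B1)" using B1 B1nz by (simp add: degree_mult_eq del: mult_pCons_left)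
    have "fps_of_poly [:-a, 1:] * (fps_of_poly B1 * F) = fps_of_poly [:-a, 1:] * fps_of_poly P1"
      using less.prems(2) unfolding B1 P1 fps_of_poly_mult by (simp only: mult.assoc)
    moreover have "fps_of_poly [:-a, 1:] \<noteq> 0"
      by (metis fps_of_poly_0 fps_of_poly_eq_iff pCons_eq_0_iff one_neq_zero)
    ultimately have "fps_of_poly B1 * F = fps_of_poly P1" by simp
    moreover have "degree P1 \<le> m"
    proof (cases "P1 = 0")
      case False
      then have "degree P = Suc (degree P1)" using P1 by (simp add: degree_mult_eq del: mult_pCons_left)
      then show ?thesis using less.prems(3) by simp
    qed simp
    ultimately show ?thesis
      using less.hyps[of B1 P1] dB B1nz less.prems(4) by simp
  qed
qed

theorem theorem5:
  fixes m :: nat and g :: "complex \<Rightarrow> complex"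
  assumes "m \<ge> 1"
    and "g holomorphic_on unit_disk"
    and "\<And>n :: nat. (\<lambda>z. z ^ n * g z) \<in> I_class n m"
  shows "holomorphic_rational_on m m unit_disk g"
proof -
  define F where "F = fps_expansion g 0"
  note F = fps_expansion_disk[OF assms(2), folded F_def]
  have "F \<in> fps_class m"
    unfolding fps_class_def
  proof (intro CollectI conjI allI impI)
    fix n and p :: "complex poly" assume "degree p \<le> n"
    then have "disk_zeros (\<lambda>z. z ^ n * g z + poly p z) \<le> enat (m + n)"
      using assms(3)[of n] by (auto simp: I_class_def)
    then have "few_zeros (m + n) (\<lambda>z. z ^ n * g z + poly p z)"
      using zcount_le_disk_zeros[of _ "m + n"] zero_less_one unfolding few_zeros_def by blast
    then show "few_zeros (m + n) (\<lambda>z. z ^ n * eval_fps F z + poly p z)"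
      by (rule iffD1[OF few_zeros_cong, rotated]) (use F(2) in auto)
  qed (rule F(1))
  then obtain P\<^sub>0 B\<^sub>0 where PB: "degree P\<^sub>0 \<le> m" "degree B\<^sub>0 \<le> m" "B\<^sub>0 \<noteq> 0"
    "fps_of_poly B\<^sub>0 * F = fps_of_poly P\<^sub>0"
    by (rule fps_class_rational)
  obtain P B where PB: "degree P \<le> m" "degree B \<le> m" "B \<noteq> 0" "fps_of_poly B * F = fps_of_poly P"
    "\<forall>z\<in>ball 0 1. poly B z \<noteq> 0"
    using cancel_common_roots[OF F(1) PB(3,4,1,2)] by blast
  have "poly B z * g z = poly P z" if "norm z < 1" for z
    using arg_cong[OF PB(4), of "\<lambda>H. eval_fps H z"] that F by (simp add: eval_disk_fps)
  then have "g z = poly P z / poly B z" if "norm z < 1" for z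
    using that PB(5) by (simp add: field_simps)
  then show ?thesis
    unfolding holomorphic_rational_on_def using PB by (intro exI[of _ P] exI[of _ B]) auto
qed

end
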